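(* Let $\psi:\Sigma^2\to\mathcal H^3$ be a Riemannian immersion of a complete surface of nonnegative Gaussian curvature $K_\Sigma$ into the $3$-dimensional Steady State space $\mathcal H^3=-\mathbb R\times_{e^t}\mathbb R^2$, with constant mean curvature $H\ge1$. Let $h$ be its height function. If $$|\nabla h|^2\le H^2-1$$ on $\Sigma$, then $\psi(\Sigma)$ is a slice of $\mathcal H^3$, i.e. $\psi(\Sigma)=\{t_0\}\times\mathbb R^2$ for some $t_0\in\mathbb R$.
   Context: The Steady State space $\mathcal H^{3}=-\mathbb R\times_{e^t}\mathbb R^2$ is the manifold $\mathbb R\times\mathbb R^2$ with the Lorentzian metric $\langle\,,\rangle=-dt^2+e^{2t}\langle\,,\rangle_{\mathbb R^2}$, where $\langle\,,\rangle_{\mathbb R^2}$ is the Euclidean metric; $\partial_t$ is the coordinate vector field of the first factor, and the slices are the sets $\{t_0\}\times\mathbb R^2$. A Riemannian immersion is an immersion of a connected, orientable surface $\Sigma^2$ such that the induced metric on $\Sigma$ is Riemannian (it is not assumed to be a graph); completeness, $K_\Sigma$, the gradient $\nabla$ and its norm refer to this induced metric. The height function $h:\Sigma\to\mathbb R$ is the composition of $\psi$ with the projection onto the first factor $\mathbb R$. $\Sigma$ is oriented by the timelike unit normal field $N$ with $\langle N,\partial_t\rangle<0$. With $\overline\nabla$ the Levi-Civita connection of $\mathcal H^{3}$, the shape operator is $AX=-\overline\nabla_XN$ and the mean curvature is $H=-\mathrm{tr}(A)/2$ (with this convention the slices, oriented by $N=\partial_t$, have $H=1$). *)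

theory Defs
  imports "HOL-Analysis.Analysis"
begin

text \<open>Maps of class \<open>C\<^sup>k\<close> and \<open>C\<^sup>\<infinity>\<close> on an open subset of a Euclidean space.\<close>

fun Ck_on :: "nat \<Rightarrow> 'a::euclidean_space set \<Rightarrow> ('a \<Rightarrow> 'b::real_normed_vector) \<Rightarrow> bool" where
  "Ck_on 0 S f \<longleftrightarrow> continuous_on S f"
| "Ck_on (Suc k) S f \<longleftrightarrow> (\<forall>x\<in>S. f differentiable (at x)) \<and>
     (\<forall>v. Ck_on k S (\<lambda>x. frechet_derivative f (at x) v))"

definition smooth_on :: "'a::euclidean_space set \<Rightarrow> ('a \<Rightarrow> 'b::real_normed_vector) \<Rightarrow> bool" where
  "smooth_on S f \<longleftrightarrow> (\<forall>k. Ck_on k S f)"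


text \<open>A smooth structure on a surface is given by an atlas of local parametrizations:
  pairs \<open>(V, x)\<close> where \<open>x\<close> maps the open set \<open>V\<close> of the plane homeomorphically
  onto an open set of the surface.  The surface is a whole type \<open>'s\<close>, whose type classes
  require it to be Hausdorff and second countable.\<close>

type_synonym 's atlas = "((real^2) set \<times> (real^2 \<Rightarrow> 's)) set"

definition transition_dom :: "(real^2) set \<Rightarrow> (real^2 \<Rightarrow> 's) \<Rightarrow> (real^2) set \<Rightarrow> (real^2 \<Rightarrow> 's) \<Rightarrow> (real^2) set" where
  "transition_dom V x W y = {u \<in> V. x u \<in> y ` W}"

definition transition :: "(real^2 \<Rightarrow> 's) \<Rightarrow> (real^2) set \<Rightarrow> (real^2 \<Rightarrow> 's) \<Rightarrow> real^2 \<Rightarrow> real^2" where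
  "transition x W y = inv_into W y \<circ> x"

definition smooth_atlas :: "'s::{t2_space,second_countable_topology} atlas \<Rightarrow> bool" where
  "smooth_atlas A \<longleftrightarrow>
     (\<forall>(V, x)\<in>A. open V \<and> open (x ` V) \<and> homeomorphism V (x ` V) x (inv_into V x)) \<and>
     (\<Union>(V, x)\<in>A. x ` V) = UNIV \<and>
     (\<forall>(V, x)\<in>A. \<forall>(W, y)\<in>A. smooth_on (transition_dom V x W y) (transition x W y))"

definition orientable_atlas :: "'s::{t2_space,second_countable_topology} atlas \<Rightarrow> bool" where
  "orientable_atlas A \<longleftrightarrow>
     (\<exists>B. smooth_atlas B \<and> smooth_atlas (A \<union> B) \<and>
        (\<forall>(V, x)\<in>B. \<forall>(W, y)\<in>B. \<forall>u\<in>transition_dom V x W y.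
           det (matrix (frechet_derivative (transition x W y) (at u))) > 0))"


text \<open>Semi-Riemannian metrics on (open subsets of) a Euclidean space: \<open>g p v w\<close> is the
  product of the tangent vectors \<open>v\<close>, \<open>w\<close> at \<open>p\<close>.\<close>

type_synonym 'a metric_form = "'a \<Rightarrow> 'a \<Rightarrow> 'a \<Rightarrow> real"

text \<open>The Koszul formula for the constant (hence commuting) vector fields \<open>u\<close>, \<open>v\<close>, \<open>w\<close>:
  \<open>christoffel g p u v\<close> is the value at \<open>p\<close> of the Levi-Civita derivative of \<open>v\<close> along \<open>u\<close>.
  On coordinate fields this gives the usual Christoffel symbols.\<close>

definition christoffel :: "'a::euclidean_space metric_form \<Rightarrow> 'a \<Rightarrow> 'a \<Rightarrow> 'a \<Rightarrow> 'a" where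
  "christoffel g p u v = (THE z. \<forall>w. 2 * g p z w =
       frechet_derivative (\<lambda>q. g q v w) (at p) u
     + frechet_derivative (\<lambda>q. g q u w) (at p) v
     - frechet_derivative (\<lambda>q. g q u v) (at p) w)"

text \<open>Levi-Civita covariant derivative of a vector field \<open>Y\<close> along a map \<open>F\<close>,
  at the point \<open>x\<close> and in the direction \<open>v\<close>.\<close>

definition cov_deriv ::
  "'a::euclidean_space metric_form \<Rightarrow> ('b::euclidean_space \<Rightarrow> 'a) \<Rightarrow> ('b \<Rightarrow> 'a) \<Rightarrow> 'b \<Rightarrow> 'b \<Rightarrow> 'a" where
  "cov_deriv g F Y x v = frechet_derivative Y (at x) v
     + christoffel g (F x) (frechet_derivative F (at x) v) (Y x)"

text \<open>\<open>R(u,v)w\<close>, with the sign making round spheres positively curved below;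
  there is no bracket term, as \<open>u\<close>, \<open>v\<close>, \<open>w\<close> are extended to constant fields.\<close>

definition riemann_curvature :: "'a::euclidean_space metric_form \<Rightarrow> 'a \<Rightarrow> 'a \<Rightarrow> 'a \<Rightarrow> 'a \<Rightarrow> 'a" where
  "riemann_curvature g p u v w =
     cov_deriv g (\<lambda>q. q) (\<lambda>q. cov_deriv g (\<lambda>r. r) (\<lambda>_. w) q v) p u
   - cov_deriv g (\<lambda>q. q) (\<lambda>q. cov_deriv g (\<lambda>r. r) (\<lambda>_. w) q u) p v"

definition gauss_curvature :: "(real^2) metric_form \<Rightarrow> real^2 \<Rightarrow> real" where
  "gauss_curvature g p = (let u = axis 1 1; v = axis 2 1 in
     g p (riemann_curvature g p u v v) u / (g p u u * g p v v - (g p u v)\<^sup>2))"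

definition gradient :: "'a::euclidean_space metric_form \<Rightarrow> ('a \<Rightarrow> real) \<Rightarrow> 'a \<Rightarrow> 'a" where
  "gradient g f p = (THE z. \<forall>v. g p z v = frechet_derivative f (at p) v)"

definition norm_sq :: "'a metric_form \<Rightarrow> 'a \<Rightarrow> 'a \<Rightarrow> real" where
  "norm_sq g p v = g p v v"


text \<open>The Steady State space: the first component of a point is the time coordinate \<open>t\<close>.\<close>

type_synonym steady_state = "real \<times> (real^2)"

definition steady_metric :: "steady_state metric_form" where
  "steady_metric p X Y = - (fst X * fst Y) + exp (2 * fst p) * (snd X \<bullet> snd Y)"

definition del_t :: steady_state where
  "del_t = (1, 0)"

definition slice :: "real \<Rightarrow> steady_state set" where
  "slice t0 = {t0} \<times> UNIV"


text \<open>Below, \<open>F\<close> stands for the local expression \<open>\<psi> \<circ> x\<close> of an immersion \<open>\<psi>\<close> in a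
  parametrization \<open>(V, x)\<close>.\<close>

definition induced_metric :: "(real^2 \<Rightarrow> steady_state) \<Rightarrow> (real^2) metric_form" where
  "induced_metric F u v w =
     steady_metric (F u) (frechet_derivative F (at u) v) (frechet_derivative F (at u) w)"

definition riemannian_immersion ::
  "'s::{t2_space,second_countable_topology} atlas \<Rightarrow> ('s \<Rightarrow> steady_state) \<Rightarrow> bool" where
  "riemannian_immersion A \<psi> \<longleftrightarrow>
     (\<forall>(V, x)\<in>A. smooth_on V (\<psi> \<circ> x) \<and>
        (\<forall>u\<in>V. inj (frechet_derivative (\<psi> \<circ> x) (at u)) \<and>
           (\<forall>v. v \<noteq> 0 \<longrightarrow> induced_metric (\<psi> \<circ> x) u v v > 0)))"

definition height :: "('s \<Rightarrow> steady_state) \<Rightarrow> 's \<Rightarrow> real" where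
  "height \<psi> = fst \<circ> \<psi>"

definition future_unit_normal ::
  "'s::{t2_space,second_countable_topology} atlas \<Rightarrow> ('s \<Rightarrow> steady_state) \<Rightarrow> ('s \<Rightarrow> steady_state) \<Rightarrow> bool" where
  "future_unit_normal A \<psi> N \<longleftrightarrow>
     (\<forall>p. steady_metric (\<psi> p) (N p) (N p) = -1 \<and> steady_metric (\<psi> p) (N p) del_t < 0) \<and>
     (\<forall>(V, x)\<in>A. smooth_on V (N \<circ> x) \<and>
        (\<forall>u\<in>V. \<forall>v. steady_metric (\<psi> (x u)) (N (x u)) (frechet_derivative (\<psi> \<circ> x) (at u) v) = 0))"

text \<open>Here \<open>N\<close> is the local expression of the normal field, a vector field along \<open>F\<close>.
  The vector \<open>w\<close> is the coordinate expression of \<open>A v\<close>.\<close>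

definition shape_operator ::
  "(real^2 \<Rightarrow> steady_state) \<Rightarrow> (real^2 \<Rightarrow> steady_state) \<Rightarrow> real^2 \<Rightarrow> real^2 \<Rightarrow> real^2" where
  "shape_operator F N u v =
     (THE w. frechet_derivative F (at u) w = - cov_deriv steady_metric F N u v)"

definition mean_curvature ::
  "(real^2 \<Rightarrow> steady_state) \<Rightarrow> (real^2 \<Rightarrow> steady_state) \<Rightarrow> real^2 \<Rightarrow> real" where
  "mean_curvature F N u = - trace (matrix (shape_operator F N u)) / 2"


text \<open>\<open>C\<^sup>1\<close> on the closed interval from \<open>a\<close> to \<open>b\<close>, with one-sided derivatives at
  the endpoints.\<close>

definition C1_curve ::
  "'s::{t2_space,second_countable_topology} atlas \<Rightarrow> real \<Rightarrow> real \<Rightarrow> (real \<Rightarrow> 's) \<Rightarrow> bool" where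
  "C1_curve A a b \<gamma> \<longleftrightarrow> continuous_on {a..b} \<gamma> \<and>
     (\<forall>(V, x)\<in>A. let J = {t\<in>{a..b}. \<gamma> t \<in> x ` V} in
        \<exists>D. continuous_on J D \<and>
          (\<forall>t\<in>J. ((inv_into V x \<circ> \<gamma>) has_vector_derivative D t) (at t within J)))"

text \<open>\<open>E\<close> is the set of break points.\<close>

definition piecewise_C1_curve ::
  "'s::{t2_space,second_countable_topology} atlas \<Rightarrow> (real \<Rightarrow> 's) \<Rightarrow> bool" where
  "piecewise_C1_curve A \<gamma> \<longleftrightarrow> (\<exists>E. finite E \<and>
     (\<forall>a b. 0 \<le> a \<longrightarrow> a < b \<longrightarrow> b \<le> 1 \<longrightarrow> {a<..<b} \<inter> E = {} \<longrightarrow> C1_curve A a b \<gamma>))"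

text \<open>Length in the induced metric: the induced norm of the velocity of \<open>\<gamma>\<close> is the norm of the
  velocity of \<open>\<psi> \<circ> \<gamma>\<close>.  Its values at the finitely many break points are irrelevant.\<close>

definition curve_length :: "('s \<Rightarrow> steady_state) \<Rightarrow> (real \<Rightarrow> 's) \<Rightarrow> real" where
  "curve_length \<psi> \<gamma> = integral {0..1}
     (\<lambda>t. sqrt (norm_sq steady_metric (\<psi> (\<gamma> t)) (vector_derivative (\<psi> \<circ> \<gamma>) (at t))))"

definition induced_dist ::
  "'s::{t2_space,second_countable_topology} atlas \<Rightarrow> ('s \<Rightarrow> steady_state) \<Rightarrow> 's \<Rightarrow> 's \<Rightarrow> real" where
  "induced_dist A \<psi> p q =
     Inf (curve_length \<psi> ` {\<gamma>. piecewise_C1_curve A \<gamma> \<and> \<gamma> 0 = p \<and> \<gamma> 1 = q})"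

definition complete_immersion ::
  "'s::{t2_space,second_countable_topology} atlas \<Rightarrow> ('s \<Rightarrow> steady_state) \<Rightarrow> bool" where
  "complete_immersion A \<psi> \<longleftrightarrow> Metric_space.mcomplete UNIV (induced_dist A \<psi>)"

end

theory Submission
  imports Defs
begin

text \<open>
  Let \<open>W = - \<langle>N, \<partial>\<^sub>t\<rangle> \<ge> 1\<close> and \<open>S = - A\<close>.  Then \<open>|\<nabla>h|\<^sup>2 = W\<^sup>2 - 1\<close>, so that \<open>W \<le> H\<close>,
  and \<open>\<nabla>W = (S - W) \<nabla>h\<close>.  The Gauss equation reads \<open>K = 1 - det S\<close>; with \<open>K \<ge> 0\<close> and
  \<open>tr S = 2 H\<close> it gives \<open>det (S - W) \<le> - 2 (H - 1)\<close> and \<open>0 \<le> tr (S - W) \<le> 2 (H - 1)\<close>.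
  Hence for \<open>H > 1\<close> the eigenvalues of \<open>S - W\<close> stay away from \<open>0\<close> and \<open>|\<nabla>W|\<close> is bounded below
  by a multiple of \<open>|\<nabla>h|\<close>.  On a complete surface the bounded function \<open>W\<close> has,
  by Ekeland's variational principle, points where it is nearly maximal and its gradient is
  small; therefore \<open>W = 1\<close> everywhere and \<open>h\<close> is constant.  The same principle, applied to
  the negative distance of the horizontal projection from a point of the plane, shows that
  the surface covers the whole slice.\<close>

subsection \<open>Mixed second derivatives\<close>

text \<open>A second-order principle of Omori-Yau type would bring in geodesics and comparison
  arguments. Here first order is enough: Cayley-Hamilton for S - W turns a small gradient of W
  directly into a small |grad h|. The price is that Ekeland's principle must run in the distance
  defined by all piecewise C1 curves of the abstract surface. Two comparisons with a chart suffice
  for this: a curve leaving a coordinate ball has length bounded below, so the distance is a metric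
  and chart-continuous functions are semicontinuous for it; and coordinate segments bound the
  distance from above to first order. The bound on det (S - W) = det S - 2HW + W^2 uses det S \<le>
  1; what is left over factors as (W - 1)(2H - 1 - W), which is nonnegative for 1 \<le> W \<le> H.
  For H = 1 the estimate degenerates, but then W \<le> H alone forces W = 1. Once h = t0 is
  constant, the distance in the plane to a point that is missed has slope exp(-t0) everywhere with
  respect to the induced metric, so it has no almost critical points.\<close>

lemma smooth_on_differentiable: "smooth_on S f \<Longrightarrow> x \<in> S \<Longrightarrow> f differentiable at x"
  unfolding smooth_on_def using Ck_on.simps(2) by blast

lemma smooth_on_has_derivative:
  "smooth_on S f \<Longrightarrow> x \<in> S \<Longrightarrow> (f has_derivative frechet_derivative f (at x)) (at x)"
  using smooth_on_differentiable frechet_derivative_works by blast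

lemma smooth_on_continuous: "smooth_on S f \<Longrightarrow> continuous_on S f"
  unfolding smooth_on_def using Ck_on.simps(1) by blast

lemma smooth_on_directional: "smooth_on S f \<Longrightarrow> smooth_on S (\<lambda>x. frechet_derivative f (at x) v)"
  unfolding smooth_on_def using Ck_on.simps(2) by blast

lemma linear_frechet_derivative_smooth: "smooth_on S f \<Longrightarrow> x \<in> S \<Longrightarrow> linear (frechet_derivative f (at x))"
  by (simp add: linear_frechet_derivative smooth_on_differentiable)

text \<open>The second difference of \<open>f\<close> is symmetric in \<open>v\<close> and \<open>w\<close>, and by the mean value
  theorem it approximates either mixed derivative.\<close>

lemma second_difference_mean_value:
  fixes f :: "'a::euclidean_space \<Rightarrow> real"
  assumes f: "\<And>x. x \<in> ball u \<delta> \<Longrightarrow> f differentiable at x"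
    and df: "\<And>x. x \<in> ball u \<delta> \<Longrightarrow> (\<lambda>y. frechet_derivative f (at y) v) differentiable at x"
    and s: "0 < s" "s * (norm v + norm w) < \<delta>"
  shows "\<exists>y\<in>ball u \<delta>. f (u + s *\<^sub>R v + s *\<^sub>R w) - f (u + s *\<^sub>R v) - f (u + s *\<^sub>R w) + f u
           = s\<^sup>2 * frechet_derivative (\<lambda>y. frechet_derivative f (at y) v) (at y) w"
proof -
  have in_ball: "u + a *\<^sub>R v + b *\<^sub>R w \<in> ball u \<delta>" if "0 \<le> a" "a \<le> s" "0 \<le> b" "b \<le> s" for a b
  proof -
    have "norm (a *\<^sub>R v + b *\<^sub>R w) \<le> a * norm v + b * norm w"
      using norm_triangle_ineq[of "a *\<^sub>R v" "b *\<^sub>R w"] that by simp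
    also have "\<dots> \<le> s * norm v + s * norm w"
      using that by (intro add_mono mult_right_mono) auto
    finally show ?thesis using s by (simp add: dist_norm algebra_simps norm_minus_commute)
  qed
  \<comment> \<open>The second difference is the increment over \<open>s\<close> in direction
    \<open>v\<close> of the increment of \<open>f\<close> across \<open>s *\<^sub>R w\<close>. The
    mean value theorem is applied in direction \<open>v\<close> and then in direction
    \<open>w\<close>; the term \<open>0 *\<^sub>R w\<close> keeps both summands instances of
    \<open>dv\<close>.\<close>
  define g where "g a = f (u + a *\<^sub>R v + s *\<^sub>R w) - f (u + a *\<^sub>R v + 0 *\<^sub>R w)" for a
  have dv: "((\<lambda>a. f (u + a *\<^sub>R v + b *\<^sub>R w)) has_real_derivative
      frechet_derivative f (at (u + a *\<^sub>R v + b *\<^sub>R w)) v) (at a)"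
    if "0 \<le> a" "a \<le> s" "0 \<le> b" "b \<le> s" for a b
  proof -
    let ?D = "frechet_derivative f (at (u + a *\<^sub>R v + b *\<^sub>R w))"
    have 1: "(f has_derivative ?D) (at (u + a *\<^sub>R v + b *\<^sub>R w))"
      using f[OF in_ball[OF that]] frechet_derivative_works by blast
    have "((\<lambda>a. u + a *\<^sub>R v + b *\<^sub>R w) has_derivative (\<lambda>h. h *\<^sub>R v)) (at a)"
      by (auto intro!: derivative_eq_intros)
    from has_derivative_compose[OF this 1]
    have "((\<lambda>a. f (u + a *\<^sub>R v + b *\<^sub>R w)) has_derivative (\<lambda>h. ?D (h *\<^sub>R v))) (at a)" .
    moreover have "?D (h *\<^sub>R v) = ?D v * h" for h
      using linear_scale[OF has_derivative_linear[OF 1]] by simp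
    ultimately show ?thesis by (simp add: has_field_derivative_def mult_commute_abs)
  qed
  have "\<exists>a. 0 < a \<and> a < s \<and> g s - g 0 = (s - 0) *
     (frechet_derivative f (at (u + a *\<^sub>R v + s *\<^sub>R w)) v
      - frechet_derivative f (at (u + a *\<^sub>R v + 0 *\<^sub>R w)) v)"
    using s unfolding g_def by (intro MVT2 DERIV_diff dv) auto
  then obtain a where a: "0 < a" "a < s" "g s - g 0 = s *
     (frechet_derivative f (at (u + a *\<^sub>R v + s *\<^sub>R w)) v
      - frechet_derivative f (at (u + a *\<^sub>R v + 0 *\<^sub>R w)) v)" by auto
  let ?f = "\<lambda>y. frechet_derivative f (at y) v"
  have dw: "((\<lambda>b. ?f (u + a *\<^sub>R v + b *\<^sub>R w)) has_real_derivative
      frechet_derivative ?f (at (u + a *\<^sub>R v + b *\<^sub>R w)) w) (at b)"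
    if "0 \<le> b" "b \<le> s" for b
  proof -
    let ?D = "frechet_derivative ?f (at (u + a *\<^sub>R v + b *\<^sub>R w))"
    have "u + a *\<^sub>R v + b *\<^sub>R w \<in> ball u \<delta>" using a that by (intro in_ball) auto
    then have 1: "(?f has_derivative ?D) (at (u + a *\<^sub>R v + b *\<^sub>R w))"
      using df frechet_derivative_works by blast
    have "((\<lambda>b. u + a *\<^sub>R v + b *\<^sub>R w) has_derivative (\<lambda>h. h *\<^sub>R w)) (at b)"
      by (auto intro!: derivative_eq_intros)
    from has_derivative_compose[OF this 1]
    have "((\<lambda>b. ?f (u + a *\<^sub>R v + b *\<^sub>R w)) has_derivative (\<lambda>h. ?D (h *\<^sub>R w))) (at b)" .
    moreover have "?D (h *\<^sub>R w) = ?D w * h" for h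
      using linear_scale[OF has_derivative_linear[OF 1]] by simp
    ultimately show ?thesis by (simp add: has_field_derivative_def mult_commute_abs)
  qed
  have "\<exists>b. 0 < b \<and> b < s \<and> ?f (u + a *\<^sub>R v + s *\<^sub>R w) - ?f (u + a *\<^sub>R v + 0 *\<^sub>R w)
     = (s - 0) * frechet_derivative ?f (at (u + a *\<^sub>R v + b *\<^sub>R w)) w"
    using s by (intro MVT2 dw) auto
  then obtain b where b: "0 < b" "b < s" "?f (u + a *\<^sub>R v + s *\<^sub>R w) - ?f (u + a *\<^sub>R v + 0 *\<^sub>R w)
     = s * frechet_derivative ?f (at (u + a *\<^sub>R v + b *\<^sub>R w)) w" by auto
  show ?thesis
  proof (rule bexI)
    show "u + a *\<^sub>R v + b *\<^sub>R w \<in> ball u \<delta>" using a b by (intro in_ball) auto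
    have "f (u + s *\<^sub>R v + s *\<^sub>R w) - f (u + s *\<^sub>R v) - f (u + s *\<^sub>R w) + f u = g s - g 0"
      by (simp add: g_def)
    also have "\<dots> = s\<^sup>2 * frechet_derivative ?f (at (u + a *\<^sub>R v + b *\<^sub>R w)) w"
      unfolding a(3) b(3) by (simp add: power2_eq_square)
    finally show "f (u + s *\<^sub>R v + s *\<^sub>R w) - f (u + s *\<^sub>R v) - f (u + s *\<^sub>R w) + f u
      = s\<^sup>2 * frechet_derivative ?f (at (u + a *\<^sub>R v + b *\<^sub>R w)) w" .
  qed
qed

text \<open>Schwarz's theorem. Both mixed derivatives, each at some point near \<open>u\<close>,
  equal the same second difference divided by \<open>s\<^sup>2\<close>; continuity carries this to
  \<open>u\<close>. Continuity is asked for each fixed pair of directions, as \<open>Ck_on\<close>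
  supplies it.\<close>

lemma mixed_derivatives_commute_real:
  fixes f :: "'a::euclidean_space \<Rightarrow> real"
  assumes "open S" "u \<in> S"
    and f: "\<And>x. x \<in> S \<Longrightarrow> f differentiable at x"
    and df: "\<And>x v. x \<in> S \<Longrightarrow> (\<lambda>y. frechet_derivative f (at y) v) differentiable at x"
    and ddf: "\<And>v w. continuous_on S (\<lambda>x. frechet_derivative (\<lambda>y. frechet_derivative f (at y) v) (at x) w)"
  shows "frechet_derivative (\<lambda>y. frechet_derivative f (at y) v) (at u) w
       = frechet_derivative (\<lambda>y. frechet_derivative f (at y) w) (at u) v"
proof -
  let ?g = "\<lambda>v w x. frechet_derivative (\<lambda>y. frechet_derivative f (at y) v) (at x) w"
  have near: "\<exists>\<delta>>0. ball u \<delta> \<subseteq> S \<and> (\<forall>x\<in>ball u \<delta>. \<bar>?g v w x - ?g v w u\<bar> < e)" if "e > 0" for e v w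
  proof -
    obtain \<delta>1 where 1: "\<delta>1 > 0" "ball u \<delta>1 \<subseteq> S" using assms open_contains_ball by blast
    have "isCont (?g v w) u" using ddf[of v w] assms by (simp add: continuous_on_eq_continuous_at)
    then obtain \<delta>2 where 2: "\<delta>2 > 0" "\<And>x. dist x u < \<delta>2 \<Longrightarrow> dist (?g v w x) (?g v w u) < e"
      using \<open>e > 0\<close> unfolding continuous_at_eps_delta by blast
    have "\<forall>x\<in>ball u (min \<delta>1 \<delta>2). \<bar>?g v w x - ?g v w u\<bar> < e"
      using 2(2) by (auto simp: dist_real_def dist_commute)
    with 1 2 show ?thesis by (intro exI[of _ "min \<delta>1 \<delta>2"]) auto
  qed
  have "\<bar>?g v w u - ?g w v u\<bar> \<le> 2 * e" if e: "e > 0" for e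
  proof -
    obtain \<delta>1 where 1: "\<delta>1 > 0" "ball u \<delta>1 \<subseteq> S" "\<And>x. x \<in> ball u \<delta>1 \<Longrightarrow> \<bar>?g v w x - ?g v w u\<bar> < e"
      using near[OF e, of v w] by blast
    obtain \<delta>2 where 2: "\<delta>2 > 0" "ball u \<delta>2 \<subseteq> S" "\<And>x. x \<in> ball u \<delta>2 \<Longrightarrow> \<bar>?g w v x - ?g w v u\<bar> < e"
      using near[OF e, of w v] by blast
    \<comment> \<open>Small enough that the parallelogram lies in both balls; the summand 1 keeps
      the denominator positive when \<open>v\<close> and \<open>w\<close> vanish.\<close>
    define s where "s = min \<delta>1 \<delta>2 / (2 * (norm v + norm w + 1))"
    have pos: "norm v + norm w + 1 > 0" by (smt (verit) norm_ge_zero)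
    have s0: "s > 0" using 1 2 pos by (simp add: s_def)
    have "s * (norm v + norm w) \<le> s * (norm v + norm w + 1)" using s0 by simp
    also have "\<dots> = min \<delta>1 \<delta>2 / 2" using pos unfolding s_def by (simp add: field_simps)
    also have "\<dots> < min \<delta>1 \<delta>2" using \<open>\<delta>1 > 0\<close> \<open>\<delta>2 > 0\<close> by (simp only: min_def) (simp split: if_split)
    finally have sb: "s * (norm v + norm w) < min \<delta>1 \<delta>2" .
    let ?\<Delta> = "f (u + s *\<^sub>R v + s *\<^sub>R w) - f (u + s *\<^sub>R v) - f (u + s *\<^sub>R w) + f u"
    obtain y where y: "y \<in> ball u \<delta>1" "?\<Delta> = s\<^sup>2 * ?g v w y"
      using second_difference_mean_value[of u \<delta>1 f v s w] 1(2) f df s0 sb by (auto simp: subset_iff)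
    obtain z where z: "z \<in> ball u \<delta>2" "f (u + s *\<^sub>R w + s *\<^sub>R v) - f (u + s *\<^sub>R w) - f (u + s *\<^sub>R v) + f u = s\<^sup>2 * ?g w v z"
      using second_difference_mean_value[of u \<delta>2 f w s v] 2(2) f df s0 sb
      by (auto simp: subset_iff add.commute)
    have "s\<^sup>2 * ?g v w y = s\<^sup>2 * ?g w v z"
      using y(2) z(2) by (simp add: algebra_simps)
    then have "?g v w y = ?g w v z" using s0 by simp
    with 1(3)[OF y(1)] 2(3)[OF z(1)] show ?thesis by linarith
  qed
  \<comment> \<open>A quarter of the gap makes the gap at most half of itself.\<close>
  from this[of "\<bar>?g v w u - ?g w v u\<bar> / 4"] have "\<bar>?g v w u - ?g w v u\<bar> = 0"
    by (cases "?g v w u = ?g w v u") auto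
  then show ?thesis by simp
qed

lemma frechet_derivative_inner:
  assumes "f differentiable at x"
  shows "frechet_derivative (\<lambda>y. f y \<bullet> b) (at x) v = frechet_derivative f (at x) v \<bullet> b"
proof -
  have "((\<lambda>y. f y \<bullet> b) has_derivative (\<lambda>v. frechet_derivative f (at x) v \<bullet> b)) (at x)"
    using assms frechet_derivative_works by (auto intro!: derivative_eq_intros)
  then show ?thesis by (metis frechet_derivative_at)
qed

text \<open>Holds without differentiability: both functions admit the same derivatives at
  \<open>x\<close>, so the choice operator behind \<open>frechet_derivative\<close> returns the same
  map.\<close>

lemma frechet_derivative_cong_open:
  assumes "open S" "x \<in> S" "\<And>y. y \<in> S \<Longrightarrow> f y = g y"
  shows "frechet_derivative f (at x) = frechet_derivative g (at x)"
proof -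
  have "(f has_derivative D) (at x) \<longleftrightarrow> (g has_derivative D) (at x)" for D
    using assms has_derivative_transform_within_open by metis
  then show ?thesis by (simp add: frechet_derivative_def)
qed

text \<open>The mean value theorem with an intermediate point is a statement about real functions,
  so the identity is tested against each basis vector.\<close>

lemma mixed_derivatives_commute:
  fixes f :: "'a::euclidean_space \<Rightarrow> 'b::euclidean_space"
  assumes "open S" "u \<in> S" "smooth_on S f"
  shows "frechet_derivative (\<lambda>y. frechet_derivative f (at y) v) (at u) w
       = frechet_derivative (\<lambda>y. frechet_derivative f (at y) w) (at u) v"
proof (rule euclidean_eqI)
  fix b :: 'b
  let ?h = "\<lambda>y. f y \<bullet> b"
  have 1: "frechet_derivative ?h (at y) v = frechet_derivative f (at y) v \<bullet> b" if "y \<in> S" for y v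
    using that assms by (simp add: frechet_derivative_inner smooth_on_differentiable)
  have D: "smooth_on S (\<lambda>y. frechet_derivative f (at y) v)" for v
    using assms smooth_on_directional by blast
  have 2: "frechet_derivative (\<lambda>y. frechet_derivative ?h (at y) v) (at x) w
      = frechet_derivative (\<lambda>y. frechet_derivative f (at y) v) (at x) w \<bullet> b" if "x \<in> S" for x v w
  proof -
    have "frechet_derivative (\<lambda>y. frechet_derivative ?h (at y) v) (at x)
        = frechet_derivative (\<lambda>y. frechet_derivative f (at y) v \<bullet> b) (at x)"
      using assms that 1 by (intro frechet_derivative_cong_open) auto
    then show ?thesis by (simp add: frechet_derivative_inner[OF smooth_on_differentiable[OF D that]])
  qed
  have "frechet_derivative (\<lambda>y. frechet_derivative ?h (at y) v) (at u) w
       = frechet_derivative (\<lambda>y. frechet_derivative ?h (at y) w) (at u) v"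
  proof (rule mixed_derivatives_commute_real[OF assms(1,2)])
    show "?h differentiable at x" if "x \<in> S" for x
      using assms that by (intro differentiable_inner) (auto simp: smooth_on_differentiable)
    show "(\<lambda>y. frechet_derivative ?h (at y) v) differentiable at x" if "x \<in> S" for x v
    proof -
      have "((\<lambda>y. frechet_derivative f (at y) v \<bullet> b) has_derivative
         (\<lambda>w. frechet_derivative (\<lambda>y. frechet_derivative f (at y) v) (at x) w \<bullet> b)) (at x)"
        using smooth_on_has_derivative[OF D that] by (auto intro!: derivative_eq_intros)
      then have "((\<lambda>y. frechet_derivative ?h (at y) v) has_derivative
         (\<lambda>w. frechet_derivative (\<lambda>y. frechet_derivative f (at y) v) (at x) w \<bullet> b)) (at x)"
        by (rule has_derivative_transform_within_open[OF _ assms(1) that]) (simp add: 1)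
      then show ?thesis by (auto simp: differentiable_def)
    qed
    show "continuous_on S (\<lambda>x. frechet_derivative (\<lambda>y. frechet_derivative ?h (at y) v) (at x) w)" for v w
    proof -
      have "continuous_on S (\<lambda>x. frechet_derivative (\<lambda>y. frechet_derivative f (at y) v) (at x) w \<bullet> b)"
        by (intro continuous_intros smooth_on_continuous[OF smooth_on_directional[OF D]])
      then show ?thesis using 2 by (simp cong: continuous_on_cong)
    qed
  qed
  then show "frechet_derivative (\<lambda>y. frechet_derivative f (at y) v) (at u) w \<bullet> b
       = frechet_derivative (\<lambda>y. frechet_derivative f (at y) w) (at u) v \<bullet> b"
    using 2[OF assms(2)] by simp
qed

subsection \<open>The ambient metric and its curvature\<close>

lemma steady_metric_simps:
  "steady_metric p (X + Y) Z = steady_metric p X Z + steady_metric p Y Z"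
  "steady_metric p X (Y + Z) = steady_metric p X Y + steady_metric p X Z"
  "steady_metric p (X - Y) Z = steady_metric p X Z - steady_metric p Y Z"
  "steady_metric p X (Y - Z) = steady_metric p X Y - steady_metric p X Z"
  "steady_metric p (- X) Z = - steady_metric p X Z"
  "steady_metric p X (- Z) = - steady_metric p X Z"
  "steady_metric p (c *\<^sub>R X) Y = c * steady_metric p X Y"
  "steady_metric p X (c *\<^sub>R Y) = c * steady_metric p X Y"
  "steady_metric p 0 Y = 0"
  "steady_metric p X 0 = 0"
  by (simp_all add: steady_metric_def algebra_simps)

lemma steady_metric_commute: "steady_metric p X Y = steady_metric p Y X"
  by (simp add: steady_metric_def inner_commute)

lemma steady_metric_nondegenerate:
  assumes "\<And>w. steady_metric p X w = steady_metric p Y w"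
  shows "X = Y"
proof (rule prod_eqI)
  show "fst X = fst Y" using assms[of "(1, 0)"] by (simp add: steady_metric_def)
  have "snd X \<bullet> y = snd Y \<bullet> y" for y
    using assms[of "(0, y)"] by (simp add: steady_metric_def)
  then show "snd X = snd Y" using vector_eq_rdot by blast
qed

lemma has_derivative_steady_metric:
  assumes "(F has_derivative F') (at x)" "(Y has_derivative Y') (at x)" "(Z has_derivative Z') (at x)"
  shows "((\<lambda>x. steady_metric (F x) (Y x) (Z x)) has_derivative
     (\<lambda>v. steady_metric (F x) (Y' v) (Z x) + steady_metric (F x) (Y x) (Z' v)
        + 2 * fst (F' v) * exp (2 * fst (F x)) * (snd (Y x) \<bullet> snd (Z x)))) (at x)"
  unfolding steady_metric_def using assms
  by (auto intro!: derivative_eq_intros simp: algebra_simps)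

text \<open>The Levi-Civita connection of a warped product with warping function exp t. As
  \<open>christoffel\<close> is a definite description, it is enough that the formula solves the
  Koszul identity and that the metric is nondegenerate.\<close>

lemma christoffel_steady:
  "christoffel steady_metric p X Y =
     (exp (2 * fst p) * (snd X \<bullet> snd Y), fst X *\<^sub>R snd Y + fst Y *\<^sub>R snd X)"
  (is "_ = ?\<Gamma>")
proof -
  have 1: "frechet_derivative (\<lambda>q. steady_metric q Y Z) (at p) X
     = 2 * fst X * exp (2 * fst p) * (snd Y \<bullet> snd Z)" for X Y Z
  proof -
    have "((\<lambda>q. steady_metric q Y Z) has_derivative
       (\<lambda>X. 2 * fst X * exp (2 * fst p) * (snd Y \<bullet> snd Z))) (at p)"
      using has_derivative_steady_metric[of "\<lambda>q. q" "\<lambda>q. q" p "\<lambda>_. Y" "\<lambda>_. 0" "\<lambda>_. Z" "\<lambda>_. 0"]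
      by (simp add: steady_metric_simps)
    then show ?thesis by (metis frechet_derivative_at)
  qed
  have 2: "2 * steady_metric p ?\<Gamma> w = frechet_derivative (\<lambda>q. steady_metric q Y w) (at p) X
     + frechet_derivative (\<lambda>q. steady_metric q X w) (at p) Y
     - frechet_derivative (\<lambda>q. steady_metric q X Y) (at p) w" for w
    unfolding 1 by (simp add: steady_metric_def algebra_simps inner_commute)
  show ?thesis unfolding christoffel_def
  proof (rule the_equality)
    fix z
    assume z: "\<forall>w. 2 * steady_metric p z w = frechet_derivative (\<lambda>q. steady_metric q Y w) (at p) X
     + frechet_derivative (\<lambda>q. steady_metric q X w) (at p) Y
     - frechet_derivative (\<lambda>q. steady_metric q X Y) (at p) w"
    show "z = ?\<Gamma>"
    proof (rule steady_metric_nondegenerate)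
      fix w show "steady_metric p z w = steady_metric p ?\<Gamma> w"
        using z[rule_format, of w] 2[of w] by linarith
    qed
  qed (use 2 in blast)
qed

lemma cov_deriv_steady:
  "cov_deriv steady_metric F Y x v = frechet_derivative Y (at x) v
    + (exp (2 * fst (F x)) * (snd (frechet_derivative F (at x) v) \<bullet> snd (Y x)),
       fst (frechet_derivative F (at x) v) *\<^sub>R snd (Y x) + fst (Y x) *\<^sub>R snd (frechet_derivative F (at x) v))"
  by (simp add: cov_deriv_def christoffel_steady)

text \<open>Metric compatibility of the connection, for vector fields along a map: the two
  Christoffel terms together produce exactly the derivative of the factor exp(2t).\<close>

lemma steady_metric_compatible:
  assumes "F differentiable at x" "Y differentiable at x" "Z differentiable at x"
  shows "((\<lambda>x. steady_metric (F x) (Y x) (Z x)) has_derivative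
    (\<lambda>v. steady_metric (F x) (cov_deriv steady_metric F Y x v) (Z x)
       + steady_metric (F x) (Y x) (cov_deriv steady_metric F Z x v))) (at x)"
proof -
  note D = assms[unfolded frechet_derivative_works]
  show ?thesis
    by (rule has_derivative_eq_rhs[OF has_derivative_steady_metric[OF D]])
      (auto simp: fun_eq_iff cov_deriv_steady steady_metric_simps,
       simp add: steady_metric_def algebra_simps inner_commute)
qed

text \<open>Written out in full so that the curvature becomes an algebraic identity in the first and
  second derivatives of \<open>F\<close> and \<open>Y\<close>.\<close>

lemma cov_deriv_steady_has_derivative:
  assumes "open S" "x \<in> S" "smooth_on S F" "smooth_on S Y"
  shows "((\<lambda>q. cov_deriv steady_metric F Y q a) has_derivative (\<lambda>b.
     frechet_derivative (\<lambda>q. frechet_derivative Y (at q) a) (at x) b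
    + (exp (2 * fst (F x)) * (2 * fst (frechet_derivative F (at x) b) * (snd (frechet_derivative F (at x) a) \<bullet> snd (Y x))
        + snd (frechet_derivative (\<lambda>q. frechet_derivative F (at q) a) (at x) b) \<bullet> snd (Y x)
        + snd (frechet_derivative F (at x) a) \<bullet> snd (frechet_derivative Y (at x) b)),
       fst (frechet_derivative (\<lambda>q. frechet_derivative F (at q) a) (at x) b) *\<^sub>R snd (Y x)
       + fst (frechet_derivative F (at x) a) *\<^sub>R snd (frechet_derivative Y (at x) b)
       + fst (frechet_derivative Y (at x) b) *\<^sub>R snd (frechet_derivative F (at x) a)
       + fst (Y x) *\<^sub>R snd (frechet_derivative (\<lambda>q. frechet_derivative F (at q) a) (at x) b)))) (at x)"
proof -
  note D = smooth_on_has_derivative[OF assms(3,2)] smooth_on_has_derivative[OF assms(4,2)]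
    smooth_on_has_derivative[OF smooth_on_directional[OF assms(3)] assms(2), of a]
    smooth_on_has_derivative[OF smooth_on_directional[OF assms(4)] assms(2), of a]
  show ?thesis unfolding cov_deriv_steady
    using D by (auto intro!: derivative_eq_intros simp: algebra_simps fun_eq_iff)
qed

lemma cov_deriv_steady_differentiable:
  assumes "open S" "x \<in> S" "smooth_on S F" "smooth_on S Y"
  shows "(\<lambda>q. cov_deriv steady_metric F Y q a) differentiable at x"
  using cov_deriv_steady_has_derivative[OF assms] unfolding differentiable_def by blast

text \<open>The Steady State space is an open part of de Sitter space and has constant sectional
  curvature 1. Stating this along a map allows the Gauss equation to use it for coordinate fields of
  the surface, with no extension to the ambient space.\<close>

lemma steady_curvature:
  assumes "open S" "x \<in> S" "smooth_on S F" "smooth_on S Y"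
  shows "cov_deriv steady_metric F (\<lambda>q. cov_deriv steady_metric F Y q b) x a
       - cov_deriv steady_metric F (\<lambda>q. cov_deriv steady_metric F Y q a) x b
     = steady_metric (F x) (Y x) (frechet_derivative F (at x) b) *\<^sub>R frechet_derivative F (at x) a
     - steady_metric (F x) (Y x) (frechet_derivative F (at x) a) *\<^sub>R frechet_derivative F (at x) b"
proof -
  note D = frechet_derivative_at[OF cov_deriv_steady_has_derivative[OF assms], symmetric]
  \<comment> \<open>Symmetry of second derivatives removes every second-order term from the
    commutator; what survives comes from the Christoffel part.\<close>
  have FF: "frechet_derivative (\<lambda>q. frechet_derivative F (at q) b) (at x) a
    = frechet_derivative (\<lambda>q. frechet_derivative F (at q) a) (at x) b"
    by (rule mixed_derivatives_commute[OF assms(1,2,3)])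
  have YY: "frechet_derivative (\<lambda>q. frechet_derivative Y (at q) b) (at x) a
    = frechet_derivative (\<lambda>q. frechet_derivative Y (at q) a) (at x) b"
    by (rule mixed_derivatives_commute[OF assms(1,2,4)])
  show ?thesis
    unfolding cov_deriv_steady[of F "\<lambda>q. cov_deriv steady_metric F Y q b"]
       cov_deriv_steady[of F "\<lambda>q. cov_deriv steady_metric F Y q a"] D FF YY
    unfolding cov_deriv_steady steady_metric_def
    by (rule prod_eqI) (simp_all add: algebra_simps inner_commute)
qed

subsection \<open>Curves in the surface and their lengths\<close>

lemma linear_coords_2:
  assumes "linear (f :: real^2 \<Rightarrow> 'b::real_vector)"
  shows "f v = v $ 1 *\<^sub>R f (axis 1 1) + v $ 2 *\<^sub>R f (axis 2 1)"
proof -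
  have "v = v $ 1 *\<^sub>R axis 1 1 + v $ 2 *\<^sub>R axis 2 1"
    by (simp add: vec_eq_iff forall_2 axis_def)
  then have "f v = f (v $ 1 *\<^sub>R axis 1 1 + v $ 2 *\<^sub>R axis 2 1)" by simp
  then show ?thesis using assms by (simp add: linear_add linear_scale)
qed

text \<open>\<open>smooth_on\<close> gives continuity of the derivative only in each fixed
  direction. Expanding the moving direction in the two coordinate vectors gives joint
  continuity.\<close>

lemma continuous_on_smooth_derivative:
  fixes F :: "real^2 \<Rightarrow> 'b::real_normed_vector"
  assumes "smooth_on V F" "continuous_on S \<beta>" "continuous_on S d" "\<beta> ` S \<subseteq> V"
  shows "continuous_on S (\<lambda>s. frechet_derivative F (at (\<beta> s)) (d s))"
proof -
  have *: "continuous_on S (\<lambda>s. frechet_derivative F (at (\<beta> s)) w)" for w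
    by (rule continuous_on_compose2[OF smooth_on_continuous[OF smooth_on_directional[OF assms(1)]] assms(2,4)])
  have "continuous_on S (\<lambda>s. d s $ 1 *\<^sub>R frechet_derivative F (at (\<beta> s)) (axis 1 1)
     + d s $ 2 *\<^sub>R frechet_derivative F (at (\<beta> s)) (axis 2 1))"
    by (intro continuous_intros * assms)
  moreover have "frechet_derivative F (at (\<beta> s)) (d s) = d s $ 1 *\<^sub>R frechet_derivative F (at (\<beta> s)) (axis 1 1)
     + d s $ 2 *\<^sub>R frechet_derivative F (at (\<beta> s)) (axis 2 1)" if "s \<in> S" for s
    using that assms by (intro linear_coords_2 linear_frechet_derivative_smooth[of V]) auto
  ultimately show ?thesis by (simp cong: continuous_on_cong)
qed

lemma continuous_on_steady_metric:
  assumes "continuous_on S F" "continuous_on S X" "continuous_on S Y"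
  shows "continuous_on S (\<lambda>s. steady_metric (F s) (X s) (Y s))"
  unfolding steady_metric_def by (intro continuous_intros assms)

text \<open>A piecewise C1 curve is controlled only on intervals whose interior avoids the break
  points. A property that survives concatenation then holds on every subinterval, by splitting at
  one break point after another.\<close>

lemma interval_induct_avoiding_finite:
  fixes Q :: "real \<Rightarrow> real \<Rightarrow> bool"
  assumes "finite E"
    and base: "\<And>a b. l \<le> a \<Longrightarrow> a < b \<Longrightarrow> b \<le> r \<Longrightarrow> {a<..<b} \<inter> E = {} \<Longrightarrow> Q a b"
    and join: "\<And>a c b. l \<le> a \<Longrightarrow> a < c \<Longrightarrow> c < b \<Longrightarrow> b \<le> r \<Longrightarrow> Q a c \<Longrightarrow> Q c b \<Longrightarrow> Q a b"
    and ab: "l \<le> a" "a < b" "b \<le> r"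
  shows "Q a b"
proof -
  have "Q a b" if "finite G" "l \<le> a" "a < b" "b \<le> r" "{a<..<b} \<inter> E \<subseteq> G" for G a b
    using that
  proof (induction G arbitrary: a b rule: finite_induct)
    case empty
    then show ?case using base[of a b] by auto
  next
    case (insert e G)
    show ?case
    proof (cases "e \<in> {a<..<b}")
      case True
      have "{a<..<e} \<inter> E \<subseteq> {a<..<b} \<inter> E - {e}" "{e<..<b} \<inter> E \<subseteq> {a<..<b} \<inter> E - {e}"
        using True by auto
      then have "{a<..<e} \<inter> E \<subseteq> G" "{e<..<b} \<inter> E \<subseteq> G" using insert.prems by blast+
      then have "Q a e" "Q e b" using insert.prems True by (auto intro!: insert.IH)
      then show ?thesis using join[of a e b] insert.prems True by auto
    next
      case False
      then have "{a<..<b} \<inter> E \<subseteq> G" using insert.prems by auto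
      then show ?thesis using insert by blast
    qed
  qed
  from this[OF \<open>finite E\<close> ab] show ?thesis by blast
qed

section \<open>Charts, velocities and speeds of curves in a spacelike surface\<close>

locale spacelike_surface =
  fixes A :: "'s::{t2_space,second_countable_topology} atlas" and \<psi> :: "'s \<Rightarrow> steady_state"
  assumes atlas: "smooth_atlas A" and immersion: "riemannian_immersion A \<psi>"
begin

text \<open>The integrand of \<open>curve_length\<close>. The derivative is two-sided, so the values
  at break points and at 0 and 1 are not controlled; facts about lengths are therefore phrased with
  \<open>has_integral\<close>, which ignores finitely many points.\<close>

definition speed :: "(real \<Rightarrow> 's) \<Rightarrow> real \<Rightarrow> real" where
  "speed \<gamma> t = sqrt (norm_sq steady_metric (\<psi> (\<gamma> t)) (vector_derivative (\<psi> \<circ> \<gamma>) (at t)))"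

lemma curve_length_eq: "curve_length \<psi> \<gamma> = integral {0..1} (speed \<gamma>)"
  by (simp add: curve_length_def speed_def[abs_def])

lemma chart:
  assumes "(V, x) \<in> A"
  shows "open V" "open (x ` V)" "continuous_on V x" "continuous_on (x ` V) (inv_into V x)"
    "inj_on x V" "smooth_on V (\<psi> \<circ> x)"
proof -
  show V: "open V" "open (x ` V)" using atlas assms by (auto simp: smooth_atlas_def)
  have h: "homeomorphism V (x ` V) x (inv_into V x)" using atlas assms by (auto simp: smooth_atlas_def)
  then show "continuous_on V x" "continuous_on (x ` V) (inv_into V x)"
    by (auto simp: homeomorphism_def)
  show "inj_on x V" using h unfolding homeomorphism_def by (metis inj_onI)
  show "smooth_on V (\<psi> \<circ> x)" using immersion assms by (auto simp: riemannian_immersion_def)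
qed

lemma chart_inv: "(V, x) \<in> A \<Longrightarrow> u \<in> V \<Longrightarrow> inv_into V x (x u) = u"
  using chart(5) by simp

lemma chart_open_image: "(V, x) \<in> A \<Longrightarrow> open U \<Longrightarrow> U \<subseteq> V \<Longrightarrow> open (x ` U)"
proof -
  assume A: "(V, x) \<in> A" "open U" "U \<subseteq> V"
  have "x ` U = x ` V \<inter> inv_into V x -` U"
    using A chart_inv[OF A(1)] by (auto simp: image_iff subset_iff)
  moreover have "open (x ` V \<inter> inv_into V x -` U)"
    by (rule continuous_open_preimage[OF chart(4,2)[OF A(1)] A(2)])
  ultimately show ?thesis by simp
qed

lemma chart_ex: "\<exists>V x u. (V, x) \<in> A \<and> u \<in> V \<and> x u = p"
proof -
  have "p \<in> (\<Union>(V, x)\<in>A. x ` V)" using atlas by (simp add: smooth_atlas_def)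
  then show ?thesis by auto
qed

lemma chart_g_pos:
  "(V, x) \<in> A \<Longrightarrow> u \<in> V \<Longrightarrow> v \<noteq> 0 \<Longrightarrow> induced_metric (\<psi> \<circ> x) u v v > 0"
  using immersion by (auto simp: riemannian_immersion_def)

lemma chart_g_nonneg:
  assumes "(V, x) \<in> A" "u \<in> V" shows "induced_metric (\<psi> \<circ> x) u v v \<ge> 0"
proof (cases "v = 0")
  case True
  have "linear (frechet_derivative (\<psi> \<circ> x) (at u))"
    by (rule linear_frechet_derivative_smooth[OF chart(6)[OF assms(1)] assms(2)])
  then show ?thesis using True by (simp add: induced_metric_def linear_0 steady_metric_def)
qed (use chart_g_pos[OF assms] in \<open>auto intro: less_imp_le\<close>)

text \<open>Unpacks \<open>C1_curve\<close> in one chart: the coordinate velocity, and by the chain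
  rule the velocity of the image in the ambient space. Derivatives are moved from the set of times
  spent in the chart to the whole interval, which makes them independent of the chart.\<close>

lemma chart_velocity:
  assumes C: "C1_curve A a b \<gamma>" and "a < b" and Vx: "(V, x) \<in> A"
  obtains d where "continuous_on {t\<in>{a..b}. \<gamma> t \<in> x ` V} d"
    "continuous_on {t\<in>{a..b}. \<gamma> t \<in> x ` V} (inv_into V x \<circ> \<gamma>)"
    "\<And>t. t \<in> {a..b} \<Longrightarrow> \<gamma> t \<in> x ` V \<Longrightarrow>
      ((inv_into V x \<circ> \<gamma>) has_vector_derivative d t) (at t within {a..b})"
    "\<And>t. t \<in> {a..b} \<Longrightarrow> \<gamma> t \<in> x ` V \<Longrightarrow>
      ((\<psi> \<circ> \<gamma>) has_vector_derivative
        frechet_derivative (\<psi> \<circ> x) (at (inv_into V x (\<gamma> t))) (d t)) (at t within {a..b})"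
    "\<And>t. t \<in> {a..b} \<Longrightarrow> \<gamma> t \<in> x ` V \<Longrightarrow>
      at t within {t\<in>{a..b}. \<gamma> t \<in> x ` V} = at t within {a..b}"
proof -
  let ?J = "{t\<in>{a..b}. \<gamma> t \<in> x ` V}"
  have cont: "continuous_on {a..b} \<gamma>" using C by (simp add: C1_curve_def)
  obtain d where d: "continuous_on ?J d"
    "\<And>t. t \<in> ?J \<Longrightarrow> ((inv_into V x \<circ> \<gamma>) has_vector_derivative d t) (at t within ?J)"
    using C Vx unfolding C1_curve_def Let_def by blast
  \<comment> \<open>The times spent in the chart form a relatively open subset of
    \<open>{a..b}\<close>, so near each of them the two filters coincide.\<close>
  obtain T where T: "open T" "T \<inter> {a..b} = \<gamma> -` (x ` V) \<inter> {a..b}"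
    using cont chart(2)[OF Vx] unfolding continuous_on_open_invariant by blast
  have J: "at t within ?J = at t within {a..b}" if "t \<in> ?J" for t
    by (rule at_within_nhd[of t T]) (use T that in blast)+
  have \<beta>: "continuous_on ?J (inv_into V x \<circ> \<gamma>)"
    by (rule continuous_on_compose)
      (auto intro: continuous_on_subset[OF cont] continuous_on_subset[OF chart(4)[OF Vx]])
  have \<psi>: "((\<psi> \<circ> \<gamma>) has_vector_derivative
        frechet_derivative (\<psi> \<circ> x) (at (inv_into V x (\<gamma> t))) (d t)) (at t within ?J)" if t: "t \<in> ?J" for t
  proof (rule has_vector_derivative_transform[OF t])
    let ?\<beta> = "inv_into V x \<circ> \<gamma>" and ?F = "\<psi> \<circ> x"
    show "(\<psi> \<circ> \<gamma>) s = (?F \<circ> ?\<beta>) s" if "s \<in> ?J" for s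
      using that by (simp add: f_inv_into_f)
    have \<beta>V: "?\<beta> t \<in> V" using t by (simp add: inv_into_into)
    have F: "(?F has_derivative frechet_derivative ?F (at (?\<beta> t))) (at (?\<beta> t))"
      by (rule smooth_on_has_derivative[OF chart(6)[OF Vx] \<beta>V])
    have "(?F \<circ> ?\<beta> has_derivative (\<lambda>h. frechet_derivative ?F (at (?\<beta> t)) (h *\<^sub>R d t))) (at t within ?J)"
      using has_derivative_compose[OF d(2)[OF t, unfolded has_vector_derivative_def] F] by (simp add: o_def)
    then show "(?F \<circ> ?\<beta> has_vector_derivative frechet_derivative ?F (at (inv_into V x (\<gamma> t))) (d t)) (at t within ?J)"
      using linear_scale[OF has_derivative_linear[OF F]] by (simp add: has_vector_derivative_def)
  qed
  show ?thesis
  proof (rule that[of d])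
    show "((inv_into V x \<circ> \<gamma>) has_vector_derivative d t) (at t within {a..b})"
      if "t \<in> {a..b}" "\<gamma> t \<in> x ` V" for t
      using d(2)[of t] J[of t] that by simp
    show "((\<psi> \<circ> \<gamma>) has_vector_derivative
        frechet_derivative (\<psi> \<circ> x) (at (inv_into V x (\<gamma> t))) (d t)) (at t within {a..b})"
      if "t \<in> {a..b}" "\<gamma> t \<in> x ` V" for t
      using \<psi>[of t] J[of t] that by simp
  qed (use d \<beta> J in auto)
qed

text \<open>One-sided at the end points, so that it is continuous on \<open>{a..b}\<close>.\<close>

definition velocity :: "real \<Rightarrow> real \<Rightarrow> (real \<Rightarrow> 's) \<Rightarrow> real \<Rightarrow> steady_state" where
  "velocity a b \<gamma> t = vector_derivative (\<psi> \<circ> \<gamma>) (at t within {a..b})"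

text \<open>All three claims are local in time and are checked in a chart around the point of the
  curve. Nonnegativity holds because the velocity is tangent to a spacelike surface; the ambient
  metric alone is indefinite.\<close>

lemma C1_curve_velocity:
  assumes C: "C1_curve A a b \<gamma>" and ab: "a < b"
  shows "continuous_on {a..b} (velocity a b \<gamma>)"
    and "t \<in> {a..b} \<Longrightarrow> ((\<psi> \<circ> \<gamma>) has_vector_derivative velocity a b \<gamma> t) (at t within {a..b})"
    and "t \<in> {a..b} \<Longrightarrow> 0 \<le> norm_sq steady_metric (\<psi> (\<gamma> t)) (velocity a b \<gamma> t)"
proof -
  have *: "((\<psi> \<circ> \<gamma>) has_vector_derivative velocity a b \<gamma> t) (at t within {a..b})
    \<and> 0 \<le> norm_sq steady_metric (\<psi> (\<gamma> t)) (velocity a b \<gamma> t)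
    \<and> continuous (at t within {a..b}) (velocity a b \<gamma>)" if t: "t \<in> {a..b}" for t
  proof -
    obtain V x u where Vx: "(V, x) \<in> A" "u \<in> V" "x u = \<gamma> t" using chart_ex[of "\<gamma> t"] by blast
    let ?J = "{t\<in>{a..b}. \<gamma> t \<in> x ` V}"
    obtain d where d: "continuous_on ?J d" "continuous_on ?J (inv_into V x \<circ> \<gamma>)"
      "\<And>t. t \<in> {a..b} \<Longrightarrow> \<gamma> t \<in> x ` V \<Longrightarrow>
        ((inv_into V x \<circ> \<gamma>) has_vector_derivative d t) (at t within {a..b})"
      "\<And>t. t \<in> {a..b} \<Longrightarrow> \<gamma> t \<in> x ` V \<Longrightarrow> ((\<psi> \<circ> \<gamma>) has_vector_derivative
        frechet_derivative (\<psi> \<circ> x) (at (inv_into V x (\<gamma> t))) (d t)) (at t within {a..b})"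
      "\<And>t. t \<in> {a..b} \<Longrightarrow> \<gamma> t \<in> x ` V \<Longrightarrow> at t within ?J = at t within {a..b}"
      by (rule chart_velocity[OF C ab Vx(1)], rule that)
    have v: "velocity a b \<gamma> s = frechet_derivative (\<psi> \<circ> x) (at (inv_into V x (\<gamma> s))) (d s)" if "s \<in> ?J" for s
      unfolding velocity_def using that d(4)[of s] ab by (intro vector_derivative_within_closed_interval) auto
    have tJ: "t \<in> ?J" using t imageI[OF Vx(2), of x] Vx(3) by simp
    have "continuous_on ?J (\<lambda>s. frechet_derivative (\<psi> \<circ> x) (at ((inv_into V x \<circ> \<gamma>) s)) (d s))"
      by (rule continuous_on_smooth_derivative[OF chart(6)[OF Vx(1)] d(2,1)])
        (auto simp: inv_into_into)
    then have "continuous_on ?J (velocity a b \<gamma>)"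
      by (rule continuous_on_eq) (simp only: v o_apply)
    then have "continuous (at t within ?J) (velocity a b \<gamma>)"
      using tJ by (simp add: continuous_on_eq_continuous_within)
    then have 1: "continuous (at t within {a..b}) (velocity a b \<gamma>)" using d(5)[of t] tJ by simp
    have 2: "((\<psi> \<circ> \<gamma>) has_vector_derivative velocity a b \<gamma> t) (at t within {a..b})"
      using d(4)[of t] v[OF tJ] tJ by simp
    have inv: "inv_into V x (\<gamma> t) = u" using Vx chart_inv by metis
    have "0 \<le> norm_sq steady_metric (\<psi> (\<gamma> t)) (velocity a b \<gamma> t)"
      using chart_g_nonneg[OF Vx(1,2), of "d t"] v[OF tJ] inv Vx(3)
      by (simp add: norm_sq_def induced_metric_def)
    with 1 2 show ?thesis by blast
  qed
  then show "continuous_on {a..b} (velocity a b \<gamma>)" by (simp add: continuous_on_eq_continuous_within)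
  show "t \<in> {a..b} \<Longrightarrow> ((\<psi> \<circ> \<gamma>) has_vector_derivative velocity a b \<gamma> t) (at t within {a..b})"
    "t \<in> {a..b} \<Longrightarrow> 0 \<le> norm_sq steady_metric (\<psi> (\<gamma> t)) (velocity a b \<gamma> t)"
    using * by blast+
qed

lemma C1_curve_velocity_interior:
  assumes "C1_curve A a b \<gamma>" "a < t" "t < b"
  shows "((\<psi> \<circ> \<gamma>) has_vector_derivative velocity a b \<gamma> t) (at t)"
    and "speed \<gamma> t = sqrt (norm_sq steady_metric (\<psi> (\<gamma> t)) (velocity a b \<gamma> t))"
proof -
  have "at t within {a..b} = at t" using assms by (simp add: at_within_Icc_at)
  then show *: "((\<psi> \<circ> \<gamma>) has_vector_derivative velocity a b \<gamma> t) (at t)"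
    using C1_curve_velocity(2)[OF assms(1), of t] assms by simp
  show "speed \<gamma> t = sqrt (norm_sq steady_metric (\<psi> (\<gamma> t)) (velocity a b \<gamma> t))"
    by (simp add: speed_def vector_derivative_at[OF *])
qed

text \<open>The one-sided speed is continuous on \<open>{a..b}\<close> and differs from
  \<open>speed\<close> at most at the two end points.\<close>

lemma C1_curve_speed_has_integral:
  assumes C: "C1_curve A a b \<gamma>" and ab: "a < b"
  defines "I \<equiv> integral {a..b} (\<lambda>t. sqrt (norm_sq steady_metric (\<psi> (\<gamma> t)) (velocity a b \<gamma> t)))"
  shows "(\<lambda>t. sqrt (norm_sq steady_metric (\<psi> (\<gamma> t)) (velocity a b \<gamma> t))) integrable_on {a..b}"
    and "(speed \<gamma> has_integral I) {a..b}" and "0 \<le> I"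
proof -
  let ?s = "\<lambda>t. sqrt (norm_sq steady_metric (\<psi> (\<gamma> t)) (velocity a b \<gamma> t))"
  have "continuous_on {a..b} (\<psi> \<circ> \<gamma>)"
    by (rule continuous_on_vector_derivative) (rule C1_curve_velocity(2)[OF C ab])
  then have "continuous_on {a..b} (\<lambda>t. \<psi> (\<gamma> t))" by (simp add: o_def)
  then have "continuous_on {a..b} ?s"
    unfolding norm_sq_def
    by (intro continuous_on_real_sqrt continuous_on_steady_metric C1_curve_velocity(1)[OF C ab])
  then show 1: "?s integrable_on {a..b}" by (rule integrable_continuous_real)
  then have "(?s has_integral I) {a..b}" by (simp add: I_def integrable_integral)
  then show "(speed \<gamma> has_integral I) {a..b}"
    by (rule has_integral_spike_finite[where S="{a, b}", rotated 2])
      (auto simp: C1_curve_velocity_interior(2)[OF C])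
  show "0 \<le> I" unfolding I_def
    by (rule integral_nonneg[OF 1]) (simp add: C1_curve_velocity(3)[OF C ab])
qed

lemma piecewise_speed_has_integral:
  assumes P: "piecewise_C1_curve A \<gamma>" and "0 \<le> a" "a < b" "b \<le> 1"
  shows "\<exists>I\<ge>0. (speed \<gamma> has_integral I) {a..b}"
proof -
  obtain E where E: "finite E" "\<And>a b. 0 \<le> a \<Longrightarrow> a < b \<Longrightarrow> b \<le> 1 \<Longrightarrow> {a<..<b} \<inter> E = {} \<Longrightarrow> C1_curve A a b \<gamma>"
    using P unfolding piecewise_C1_curve_def by blast
  show ?thesis
  proof (rule interval_induct_avoiding_finite[OF E(1) _ _ assms(2-4)])
    show "\<exists>I\<ge>0. (speed \<gamma> has_integral I) {a..b}" if "0 \<le> a" "a < b" "b \<le> 1" "{a<..<b} \<inter> E = {}" for a b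
      using C1_curve_speed_has_integral(2,3)[OF E(2)[OF that] that(2)] by blast
    show "\<exists>I\<ge>0. (speed \<gamma> has_integral I) {a..b}"
      if "a < c" "c < b" "\<exists>I\<ge>0. (speed \<gamma> has_integral I) {a..c}" "\<exists>I\<ge>0. (speed \<gamma> has_integral I) {c..b}" for a b c
      using that has_integral_combine[of a c b "speed \<gamma>"] by (meson add_nonneg_nonneg less_imp_le)
  qed
qed

lemma piecewise_continuous:
  assumes P: "piecewise_C1_curve A \<gamma>" shows "continuous_on {0..1} \<gamma>"
proof -
  obtain E where E: "finite E" "\<And>a b. 0 \<le> a \<Longrightarrow> a < b \<Longrightarrow> b \<le> 1 \<Longrightarrow> {a<..<b} \<inter> E = {} \<Longrightarrow> C1_curve A a b \<gamma>"
    using P unfolding piecewise_C1_curve_def by blast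
  show ?thesis
  proof (rule interval_induct_avoiding_finite[OF E(1), of 0 1])
    show "continuous_on {a..b} \<gamma>" if "0 \<le> a" "a < b" "b \<le> 1" "{a<..<b} \<inter> E = {}" for a b
      using E(2)[OF that] by (simp add: C1_curve_def)
    show "continuous_on {a..b} \<gamma>" if "a < c" "c < b" "continuous_on {a..c} \<gamma>" "continuous_on {c..b} \<gamma>" for a b c
    proof -
      have "{a..b} = {a..c} \<union> {c..b}" using that by auto
      then show ?thesis using continuous_on_closed_Un[OF _ _ that(3,4)] by simp
    qed
  qed auto
qed

lemma curve_length_has_integral:
  "piecewise_C1_curve A \<gamma> \<Longrightarrow> (speed \<gamma> has_integral curve_length \<psi> \<gamma>) {0..1}"
  using piecewise_speed_has_integral[of \<gamma> 0 1] unfolding curve_length_eq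
  by (auto simp: has_integral_integrable_integral)

lemma curve_length_nonneg:
  assumes "piecewise_C1_curve A \<gamma>" shows "0 \<le> curve_length \<psi> \<gamma>"
  using piecewise_speed_has_integral[OF assms, of 0 1] curve_length_has_integral[OF assms]
  by (metis has_integral_unique order_refl zero_less_one)

text \<open>On a C1 piece the coordinate displacement is the integral of the coordinate velocity,
  whose norm times \<open>c\<close> is at most the speed. Pieces add up by the triangle
  inequality.\<close>

lemma length_in_chart:
  assumes P: "piecewise_C1_curve A \<gamma>" and Vx: "(V, x) \<in> A" and K: "K \<subseteq> V"
    and c: "\<And>u v. u \<in> K \<Longrightarrow> c * norm v \<le> sqrt (induced_metric (\<psi> \<circ> x) u v v)" "0 \<le> c"
    and ab: "0 \<le> a" "a < b" "b \<le> 1" and \<gamma>: "\<And>t. t \<in> {a..b} \<Longrightarrow> \<gamma> t \<in> x ` K"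
  shows "\<exists>I. (speed \<gamma> has_integral I) {a..b} \<and>
    c * norm (inv_into V x (\<gamma> b) - inv_into V x (\<gamma> a)) \<le> I"
proof -
  let ?\<beta> = "inv_into V x \<circ> \<gamma>"
  obtain E where E: "finite E" "\<And>a b. 0 \<le> a \<Longrightarrow> a < b \<Longrightarrow> b \<le> 1 \<Longrightarrow> {a<..<b} \<inter> E = {} \<Longrightarrow> C1_curve A a b \<gamma>"
    using P unfolding piecewise_C1_curve_def by blast
  have "\<exists>I. (speed \<gamma> has_integral I) {a..b} \<and> c * norm (?\<beta> b - ?\<beta> a) \<le> I"
  proof (rule interval_induct_avoiding_finite[OF E(1) _ _ _ ab(2), of a b])
    fix a' b'
    assume ab': "a \<le> a'" "a' < b'" "b' \<le> b" "{a'<..<b'} \<inter> E = {}"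
    then have C: "C1_curve A a' b' \<gamma>" using E(2)[of a' b'] ab by simp
    have in_K: "\<gamma> t \<in> x ` K" if "t \<in> {a'..b'}" for t using that \<gamma>[of t] ab' by simp
    obtain d where
      "\<And>t. t \<in> {a'..b'} \<Longrightarrow> \<gamma> t \<in> x ` V \<Longrightarrow>
        (?\<beta> has_vector_derivative d t) (at t within {a'..b'})"
      "\<And>t. t \<in> {a'..b'} \<Longrightarrow> \<gamma> t \<in> x ` V \<Longrightarrow> ((\<psi> \<circ> \<gamma>) has_vector_derivative
        frechet_derivative (\<psi> \<circ> x) (at (inv_into V x (\<gamma> t))) (d t)) (at t within {a'..b'})"
      by (rule chart_velocity[OF C ab'(2) Vx], rule that)
    then have d: "\<And>t. t \<in> {a'..b'} \<Longrightarrow> (?\<beta> has_vector_derivative d t) (at t within {a'..b'})"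
      "\<And>t. t \<in> {a'..b'} \<Longrightarrow> ((\<psi> \<circ> \<gamma>) has_vector_derivative
        frechet_derivative (\<psi> \<circ> x) (at (inv_into V x (\<gamma> t))) (d t)) (at t within {a'..b'})"
      using in_K K by blast+
    have "(d has_integral (?\<beta> b' - ?\<beta> a')) {a'..b'}"
      using fundamental_theorem_of_calculus[of a' b' ?\<beta> d] d(1) ab' by simp
    then have int: "((\<lambda>t. c *\<^sub>R d t) has_integral (c *\<^sub>R (?\<beta> b' - ?\<beta> a'))) {a'..b'}"
      by (rule has_integral_cmul)
    note len = C1_curve_speed_has_integral[OF C ab'(2)]
    have "norm (integral {a'..b'} (\<lambda>t. c *\<^sub>R d t))
      \<le> integral {a'..b'} (\<lambda>t. sqrt (norm_sq steady_metric (\<psi> (\<gamma> t)) (velocity a' b' \<gamma> t)))"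
    proof (rule Henstock_Kurzweil_Integration.integral_norm_bound_integral[OF _ len(1)])
      show "(\<lambda>t. c *\<^sub>R d t) integrable_on {a'..b'}" using int by blast
      fix t assume t: "t \<in> {a'..b'}"
      obtain u where u: "u \<in> K" "\<gamma> t = x u" using in_K[OF t] by blast
      then have inv: "inv_into V x (\<gamma> t) = u" using K chart_inv[OF Vx] by auto
      have "velocity a' b' \<gamma> t = frechet_derivative (\<psi> \<circ> x) (at u) (d t)"
        unfolding velocity_def inv[symmetric]
        by (rule vector_derivative_within_closed_interval[OF ab'(2) t d(2)[OF t]])
      then show "norm (c *\<^sub>R d t) \<le> sqrt (norm_sq steady_metric (\<psi> (\<gamma> t)) (velocity a' b' \<gamma> t))"
        using c(1)[OF u(1), of "d t"] c(2) u(2) by (simp add: norm_sq_def induced_metric_def)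
    qed
    then have "norm (c *\<^sub>R (?\<beta> b' - ?\<beta> a'))
      \<le> integral {a'..b'} (\<lambda>t. sqrt (norm_sq steady_metric (\<psi> (\<gamma> t)) (velocity a' b' \<gamma> t)))"
      unfolding integral_unique[OF int] .
    then show "\<exists>I. (speed \<gamma> has_integral I) {a'..b'} \<and> c * norm (?\<beta> b' - ?\<beta> a') \<le> I"
      using len(2) c(2) by auto
  next
    fix a' e b'
    assume ord: "a' < e" "e < b'"
      and "\<exists>I. (speed \<gamma> has_integral I) {a'..e} \<and> c * norm (?\<beta> e - ?\<beta> a') \<le> I"
      and "\<exists>I. (speed \<gamma> has_integral I) {e..b'} \<and> c * norm (?\<beta> b' - ?\<beta> e) \<le> I"
    then obtain I J where I: "(speed \<gamma> has_integral I) {a'..e}" "c * norm (?\<beta> e - ?\<beta> a') \<le> I"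
      and J: "(speed \<gamma> has_integral J) {e..b'}" "c * norm (?\<beta> b' - ?\<beta> e) \<le> J" by blast
    have "norm (?\<beta> b' - ?\<beta> a') \<le> norm (?\<beta> e - ?\<beta> a') + norm (?\<beta> b' - ?\<beta> e)"
      using norm_triangle_ineq[of "?\<beta> e - ?\<beta> a'" "?\<beta> b' - ?\<beta> e"] by simp
    then have "c * norm (?\<beta> b' - ?\<beta> a') \<le> c * norm (?\<beta> e - ?\<beta> a') + c * norm (?\<beta> b' - ?\<beta> e)"
      using c(2) by (metis distrib_left mult_left_mono)
    moreover have "(speed \<gamma> has_integral (I + J)) {a'..b'}"
      using has_integral_combine[OF _ _ I(1) J(1)] ord by simp
    ultimately show "\<exists>I. (speed \<gamma> has_integral I) {a'..b'} \<and> c * norm (?\<beta> b' - ?\<beta> a') \<le> I"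
      using I(2) J(2) by (intro exI[of _ "I + J"]) auto
  qed auto
  then show ?thesis by simp
qed

text \<open>Serves reversal and both halves of a concatenation, which is why the new curve only has
  to agree with the reparametrized one on its own interval.\<close>

lemma C1_curve_affine:
  assumes C: "C1_curve A a b \<gamma>" and map: "\<And>t. t \<in> {a'..b'} \<Longrightarrow> m * t + c \<in> {a..b}"
    and eq: "\<And>t. t \<in> {a'..b'} \<Longrightarrow> \<gamma>' t = \<gamma> (m * t + c)"
  shows "C1_curve A a' b' \<gamma>'"
proof -
  have "continuous_on {a'..b'} (\<lambda>t. \<gamma> (m * t + c))"
    by (rule continuous_on_compose2[of "{a..b}" \<gamma>]) (use C map in \<open>auto simp: C1_curve_def intro!: continuous_intros\<close>)
  then have cont: "continuous_on {a'..b'} \<gamma>'"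
    by (rule continuous_on_eq) (simp add: eq)
  have "\<exists>D. continuous_on {t\<in>{a'..b'}. \<gamma>' t \<in> x ` V} D \<and>
    (\<forall>t\<in>{t\<in>{a'..b'}. \<gamma>' t \<in> x ` V}.
      ((inv_into V x \<circ> \<gamma>') has_vector_derivative D t) (at t within {t\<in>{a'..b'}. \<gamma>' t \<in> x ` V}))"
    if Vx: "(V, x) \<in> A" for V x
  proof -
    let ?J = "{t\<in>{a..b}. \<gamma> t \<in> x ` V}" and ?J' = "{t\<in>{a'..b'}. \<gamma>' t \<in> x ` V}"
    obtain d where d: "continuous_on ?J d"
      "\<And>t. t \<in> ?J \<Longrightarrow> ((inv_into V x \<circ> \<gamma>) has_vector_derivative d t) (at t within ?J)"
      using C Vx unfolding C1_curve_def Let_def by blast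
    have img: "(\<lambda>t. m * t + c) ` ?J' \<subseteq> ?J" using map eq by auto
    have "continuous_on ?J' (\<lambda>t. m *\<^sub>R d (m * t + c))"
      by (intro continuous_on_scaleR continuous_on_const continuous_on_compose2[OF d(1) _ img] continuous_intros)
    moreover have "((inv_into V x \<circ> \<gamma>') has_vector_derivative m *\<^sub>R d (m * t + c)) (at t within ?J')"
      if t: "t \<in> ?J'" for t
    proof (rule has_vector_derivative_transform[OF t])
      show "(inv_into V x \<circ> \<gamma>') s = ((inv_into V x \<circ> \<gamma>) \<circ> (\<lambda>t. m * t + c)) s" if "s \<in> ?J'" for s
        using that eq by simp
      show "(((inv_into V x \<circ> \<gamma>) \<circ> (\<lambda>t. m * t + c)) has_vector_derivative m *\<^sub>R d (m * t + c)) (at t within ?J')"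
      proof (rule vector_diff_chain_within)
        have "((\<lambda>t. m * t + c) has_real_derivative m) (at t within ?J')"
          by (auto intro!: derivative_eq_intros)
        then show "((\<lambda>t. m * t + c) has_vector_derivative m) (at t within ?J')"
          by (simp add: has_real_derivative_iff_has_vector_derivative)
        show "((inv_into V x \<circ> \<gamma>) has_vector_derivative d (m * t + c)) (at (m * t + c) within (\<lambda>t. m * t + c) ` ?J')"
          by (rule has_vector_derivative_within_subset[OF d(2) img]) (use img t in blast)
      qed
    qed
    ultimately show ?thesis by blast
  qed
  then show ?thesis using cont unfolding C1_curve_def Let_def by auto
qed

text \<open>Supplies true differentiability off a finite set, without which the chain rule says
  nothing about the chosen value \<open>vector_derivative\<close> in \<open>speed\<close>.\<close>

lemma piecewise_has_vector_derivative:
  assumes P: "piecewise_C1_curve A \<gamma>"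
  shows "\<exists>E. finite E \<and> (\<forall>s\<in>{0<..<1} - E. \<exists>v. ((\<psi> \<circ> \<gamma>) has_vector_derivative v) (at s))"
proof -
  obtain E where E: "finite E" "\<And>a b. 0 \<le> a \<Longrightarrow> a < b \<Longrightarrow> b \<le> 1 \<Longrightarrow> {a<..<b} \<inter> E = {} \<Longrightarrow> C1_curve A a b \<gamma>"
    using P unfolding piecewise_C1_curve_def by blast
  have "\<exists>v. ((\<psi> \<circ> \<gamma>) has_vector_derivative v) (at s)" if s: "s \<in> {0<..<1} - E" for s
  proof -
    have "open ({0<..<1} - E)" using E(1) by (intro open_Diff finite_imp_closed) auto
    then obtain e where e: "e > 0" "ball s e \<subseteq> {0<..<1} - E" using s open_contains_ball by blast
    have "cball s (e/2) \<subseteq> ball s e" using e by auto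
    then have sub: "{s - e/2..s + e/2} \<subseteq> {0<..<1} - E" using e(2) by (simp add: cball_eq_atLeastAtMost)
    moreover have "s - e/2 \<in> {s - e/2..s + e/2}" "s + e/2 \<in> {s - e/2..s + e/2}" using e(1) by auto
    ultimately have "s - e/2 \<in> {0<..<1}" "s + e/2 \<in> {0<..<1}" by blast+
    then have C: "C1_curve A (s - e/2) (s + e/2) \<gamma>"
      using sub e(1) by (intro E(2)) (auto simp: subset_iff)
    have "s - e/2 < s" "s < s + e/2" using e(1) by simp_all
    from C1_curve_velocity_interior(1)[OF C this] show ?thesis by blast
  qed
  with E(1) show ?thesis by blast
qed

text \<open>The substitution contributes the factor 1/|m| and the chain rule the factor |m|. By the
  equivalence \<open>map\<close>, the new interval is exactly the preimage of \<open>{0..1}\<close>,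
  so the full length is recovered.\<close>

lemma speed_has_integral_affine:
  assumes P: "piecewise_C1_curve A \<gamma>" and m: "m \<noteq> 0"
    and map: "\<And>t. t \<in> {a'..b'} \<longleftrightarrow> m * t + c \<in> {0..1}"
    and eq: "\<And>t. t \<in> {a'..b'} \<Longrightarrow> \<gamma>' t = \<gamma> (m * t + c)"
  shows "(speed \<gamma>' has_integral curve_length \<psi> \<gamma>) {a'..b'}"
proof -
  obtain E where E: "finite E" "\<And>s. s \<in> {0<..<1} - E \<Longrightarrow> \<exists>v. ((\<psi> \<circ> \<gamma>) has_vector_derivative v) (at s)"
    using piecewise_has_vector_derivative[OF P] by blast
  have img: "(\<lambda>x. (1 / m) *\<^sub>R x + - ((1 / m) *\<^sub>R c)) ` cbox 0 1 = {a'..b'}"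
  proof (rule set_eqI)
    fix t
    have "t \<in> (\<lambda>x. (1 / m) *\<^sub>R x + - ((1 / m) *\<^sub>R c)) ` cbox 0 1 \<longleftrightarrow> m * t + c \<in> {0..1}"
    proof
      assume "m * t + c \<in> {0..1}"
      then show "t \<in> (\<lambda>x. (1 / m) *\<^sub>R x + - ((1 / m) *\<^sub>R c)) ` cbox 0 1"
        using m by (intro image_eqI[of _ _ "m * t + c"]) (auto simp: field_simps)
    qed (use m in \<open>auto simp: field_simps\<close>)
    then show "t \<in> (\<lambda>x. (1 / m) *\<^sub>R x + - ((1 / m) *\<^sub>R c)) ` cbox 0 1 \<longleftrightarrow> t \<in> {a'..b'}"
      using map by simp
  qed
  have "((\<lambda>t. speed \<gamma> (m *\<^sub>R t + c)) has_integral (1 / (\<bar>m\<bar> ^ DIM(real))) *\<^sub>R curve_length \<psi> \<gamma>) {a'..b'}"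
    using has_integral_affinity[of "speed \<gamma>" "curve_length \<psi> \<gamma>" 0 1 m c] curve_length_has_integral[OF P] m
    unfolding img by simp
  from has_integral_cmul[OF this, of "\<bar>m\<bar>"]
  have "((\<lambda>t. \<bar>m\<bar> * speed \<gamma> (m * t + c)) has_integral curve_length \<psi> \<gamma>) {a'..b'}"
    using m by simp
  then show ?thesis
  proof (rule has_integral_spike_finite[rotated 2])
    \<comment> \<open>The end points of the interval, and the times mapped to 0, 1 or a point where
      the curve may fail to be differentiable.\<close>
    let ?E = "{a', b'} \<union> (\<lambda>s. (s - c) / m) ` (E \<union> {0, 1})"
    show "finite ?E" using E(1) by simp
    fix t assume t: "t \<in> {a'..b'} - ?E"
    define s where "s = m * t + c"
    have "t = (s - c) / m" using m by (simp add: s_def)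
    then have "s \<notin> E \<union> {0, 1}" using t by blast
    then have "s \<in> {0<..<1} - E" using t map[of t] by (auto simp: s_def)
    then obtain v where v: "((\<psi> \<circ> \<gamma>) has_vector_derivative v) (at s)" using E(2) by blast
    have "((\<lambda>t. m * t + c) has_real_derivative m) (at t)"
      by (auto intro!: derivative_eq_intros)
    then have "((\<lambda>t. m * t + c) has_vector_derivative m) (at t)"
      by (simp add: has_real_derivative_iff_has_vector_derivative)
    from vector_diff_chain_at[OF this] v
    have "((\<psi> \<circ> \<gamma>) \<circ> (\<lambda>t. m * t + c) has_vector_derivative m *\<^sub>R v) (at t)"
      by (simp add: s_def)
    then have "((\<psi> \<circ> \<gamma>') has_vector_derivative m *\<^sub>R v) (at t)"
      by (rule has_vector_derivative_transform_within_open[where S="{a'<..<b'}"])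
        (use t eq in auto)
    then have "vector_derivative (\<psi> \<circ> \<gamma>') (at t) = m *\<^sub>R vector_derivative (\<psi> \<circ> \<gamma>) (at s)"
      using v by (simp add: vector_derivative_at)
    moreover have "\<gamma>' t = \<gamma> s" using eq t by (simp add: s_def)
    ultimately have "speed \<gamma>' t = sqrt (m\<^sup>2 * norm_sq steady_metric (\<psi> (\<gamma> s)) (vector_derivative (\<psi> \<circ> \<gamma>) (at s)))"
      unfolding speed_def norm_sq_def by (simp add: steady_metric_def power2_eq_square algebra_simps)
    then show "speed \<gamma>' t = \<bar>m\<bar> * speed \<gamma> (m * t + c)"
      by (simp add: real_sqrt_mult speed_def s_def)
  qed
qed

lemma piecewise_reverse:
  assumes P: "piecewise_C1_curve A \<gamma>"
  shows "piecewise_C1_curve A (\<lambda>t. \<gamma> (1 - t))" "curve_length \<psi> (\<lambda>t. \<gamma> (1 - t)) = curve_length \<psi> \<gamma>"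
proof -
  obtain E where E: "finite E" "\<And>a b. 0 \<le> a \<Longrightarrow> a < b \<Longrightarrow> b \<le> 1 \<Longrightarrow> {a<..<b} \<inter> E = {} \<Longrightarrow> C1_curve A a b \<gamma>"
    using P unfolding piecewise_C1_curve_def by blast
  have "C1_curve A a b (\<lambda>t. \<gamma> (1 - t))"
    if ab: "0 \<le> a" "a < b" "b \<le> 1" "{a<..<b} \<inter> (\<lambda>t. 1 - t) ` E = {}" for a b
  proof (rule C1_curve_affine[where m = "-1" and c = 1])
    have "{1 - b<..<1 - a} \<inter> E = {}"
    proof (rule ccontr)
      assume "{1 - b<..<1 - a} \<inter> E \<noteq> {}"
      then obtain s where "s \<in> E" "1 - b < s" "s < 1 - a" by auto
      then have "1 - s \<in> {a<..<b} \<inter> (\<lambda>t. 1 - t) ` E" by auto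
      then show False using ab by blast
    qed
    then show "C1_curve A (1 - b) (1 - a) \<gamma>" using ab by (intro E(2)) auto
  qed auto
  then show 1: "piecewise_C1_curve A (\<lambda>t. \<gamma> (1 - t))"
    using E(1) unfolding piecewise_C1_curve_def by (intro exI[of _ "(\<lambda>t. 1 - t) ` E"]) auto
  have "(speed (\<lambda>t. \<gamma> (1 - t)) has_integral curve_length \<psi> \<gamma>) {0..1}"
    by (rule speed_has_integral_affine[OF P, of "-1" _ _ 1]) auto
  then show "curve_length \<psi> (\<lambda>t. \<gamma> (1 - t)) = curve_length \<psi> \<gamma>"
    using curve_length_has_integral[OF 1] has_integral_unique by blast
qed

lemma piecewise_join:
  assumes P1: "piecewise_C1_curve A \<gamma>1" and P2: "piecewise_C1_curve A \<gamma>2" and match: "\<gamma>1 1 = \<gamma>2 0"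
  defines "\<gamma> \<equiv> \<lambda>t. if t \<le> 1/2 then \<gamma>1 (2 * t) else \<gamma>2 (2 * t - 1)"
  shows "piecewise_C1_curve A \<gamma>" "curve_length \<psi> \<gamma> = curve_length \<psi> \<gamma>1 + curve_length \<psi> \<gamma>2"
proof -
  obtain E1 where E1: "finite E1" "\<And>a b. 0 \<le> a \<Longrightarrow> a < b \<Longrightarrow> b \<le> 1 \<Longrightarrow> {a<..<b} \<inter> E1 = {} \<Longrightarrow> C1_curve A a b \<gamma>1"
    using P1 unfolding piecewise_C1_curve_def by blast
  obtain E2 where E2: "finite E2" "\<And>a b. 0 \<le> a \<Longrightarrow> a < b \<Longrightarrow> b \<le> 1 \<Longrightarrow> {a<..<b} \<inter> E2 = {} \<Longrightarrow> C1_curve A a b \<gamma>2"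
    using P2 unfolding piecewise_C1_curve_def by blast
  \<comment> \<open>The junction is a break point as well, since a corner may arise there; an
    interval avoiding it lies entirely in one half.\<close>
  let ?E = "insert (1/2) ((\<lambda>t. t / 2) ` E1 \<union> (\<lambda>t. (t + 1) / 2) ` E2)"
  have \<gamma>1: "\<gamma> t = \<gamma>1 (2 * t + 0)" if "t \<le> 1/2" for t using that by (simp add: \<gamma>_def)
  \<comment> \<open>At 1/2 the definition selects the first branch; \<open>match\<close> makes the
    second formula valid there too, so that the right half can be treated as a closed
    interval.\<close>
  have \<gamma>2: "\<gamma> t = \<gamma>2 (2 * t + (- 1))" if "t \<ge> 1/2" for t
  proof (cases "t = 1/2")
    case True
    show ?thesis unfolding True by (simp add: \<gamma>_def match)
  qed (use that in \<open>simp add: \<gamma>_def\<close>)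
  have "C1_curve A a b \<gamma>" if ab: "0 \<le> a" "a < b" "b \<le> 1" "{a<..<b} \<inter> ?E = {}" for a b
  proof (cases "b \<le> 1/2")
    case True
    show ?thesis
    proof (rule C1_curve_affine[where m = 2 and c = 0 and \<gamma> = \<gamma>1])
      have "{2 * a<..<2 * b} \<inter> E1 = {}"
      proof (rule ccontr)
        assume "{2 * a<..<2 * b} \<inter> E1 \<noteq> {}"
        then obtain s where "s \<in> E1" "2 * a < s" "s < 2 * b" by auto
        then have "s / 2 \<in> {a<..<b} \<inter> ?E" by auto
        then show False using ab by blast
      qed
      then show "C1_curve A (2 * a) (2 * b) \<gamma>1" using ab True by (intro E1(2)) auto
    qed (use True \<gamma>1 in auto)
  next
    case False
    moreover have "1/2 \<notin> {a<..<b}" using ab by blast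
    ultimately have a: "1/2 \<le> a" by auto
    show ?thesis
    proof (rule C1_curve_affine[where m = 2 and c = "-1" and \<gamma> = \<gamma>2])
      have "{2 * a - 1<..<2 * b - 1} \<inter> E2 = {}"
      proof (rule ccontr)
        assume "{2 * a - 1<..<2 * b - 1} \<inter> E2 \<noteq> {}"
        then obtain s where "s \<in> E2" "2 * a - 1 < s" "s < 2 * b - 1" by auto
        then have "(s + 1) / 2 \<in> {a<..<b} \<inter> ?E" by auto
        then show False using ab by blast
      qed
      then show "C1_curve A (2 * a - 1) (2 * b - 1) \<gamma>2" using ab a by (intro E2(2)) auto
    qed (use a \<gamma>2 in auto)
  qed
  then show P: "piecewise_C1_curve A \<gamma>"
    using E1(1) E2(1) unfolding piecewise_C1_curve_def by (intro exI[of _ ?E]) auto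
  have "(speed \<gamma> has_integral curve_length \<psi> \<gamma>1) {0..1/2}"
    by (rule speed_has_integral_affine[OF P1, where m = 2 and c = 0]) (use \<gamma>1 in auto)
  moreover have "(speed \<gamma> has_integral curve_length \<psi> \<gamma>2) {1/2..1}"
    by (rule speed_has_integral_affine[OF P2, where m = 2 and c = "-1"]) (use \<gamma>2 in auto)
  ultimately have "(speed \<gamma> has_integral curve_length \<psi> \<gamma>1 + curve_length \<psi> \<gamma>2) {0..1}"
    by (rule has_integral_combine[rotated 2]) auto
  then show "curve_length \<psi> \<gamma> = curve_length \<psi> \<gamma>1 + curve_length \<psi> \<gamma>2"
    using curve_length_has_integral[OF P] has_integral_unique by blast
qed

text \<open>Coordinate segments are the test curves for upper bounds on the distance. Being C1 is
  required in every chart of the atlas, and this is where smoothness of the transition maps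
  enters.\<close>

lemma straight_curve:
  assumes Vx: "(V, x) \<in> A" and V: "\<And>t. t \<in> {0..1} \<Longrightarrow> u + t *\<^sub>R w \<in> V"
  defines "\<gamma> \<equiv> \<lambda>t. x (u + t *\<^sub>R w)"
  shows "piecewise_C1_curve A \<gamma>"
    and "t \<in> {0<..<1} \<Longrightarrow> speed \<gamma> t = sqrt (induced_metric (\<psi> \<circ> x) (u + t *\<^sub>R w) w w)"
proof -
  have line: "((\<lambda>t. u + t *\<^sub>R w) has_derivative (\<lambda>h. h *\<^sub>R w)) (at t within S)" for t S
    by (auto intro!: derivative_eq_intros)
  have "C1_curve A a b \<gamma>" if ab: "0 \<le> a" "b \<le> 1" for a b
  proof -
    have "continuous_on {a..b} \<gamma>" unfolding \<gamma>_def
      by (rule continuous_on_compose2[OF chart(3)[OF Vx]]) (use V ab in \<open>auto intro!: continuous_intros\<close>)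
    moreover have "\<exists>D. continuous_on {t \<in> {a..b}. \<gamma> t \<in> y ` W} D \<and> (\<forall>t\<in>{t \<in> {a..b}. \<gamma> t \<in> y ` W}.
        (inv_into W y \<circ> \<gamma> has_vector_derivative D t) (at t within {t \<in> {a..b}. \<gamma> t \<in> y ` W}))"
      if Wy: "(W, y) \<in> A" for W y
    proof -
    let ?J = "{t \<in> {a..b}. \<gamma> t \<in> y ` W}" and ?T = "transition x W y"
    have sm: "smooth_on (transition_dom V x W y) ?T" using atlas Vx Wy unfolding smooth_atlas_def by fast
    have dom: "u + t *\<^sub>R w \<in> transition_dom V x W y" if "t \<in> ?J" for t
      using that V ab by (auto simp: transition_dom_def \<gamma>_def)
    show ?thesis
    proof (intro exI conjI ballI)
      show "continuous_on ?J (\<lambda>t. frechet_derivative ?T (at (u + t *\<^sub>R w)) w)"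
        by (rule continuous_on_compose2[OF smooth_on_continuous[OF smooth_on_directional[OF sm]]])
          (use dom in \<open>auto intro!: continuous_intros\<close>)
      fix t assume t: "t \<in> ?J"
      have T: "(?T has_derivative frechet_derivative ?T (at (u + t *\<^sub>R w))) (at (u + t *\<^sub>R w))"
        by (rule smooth_on_has_derivative[OF sm dom[OF t]])
      have "((\<lambda>t. ?T (u + t *\<^sub>R w)) has_derivative (\<lambda>h. frechet_derivative ?T (at (u + t *\<^sub>R w)) (h *\<^sub>R w))) (at t within ?J)"
        by (rule has_derivative_compose[OF line T])
      then show "(inv_into W y \<circ> \<gamma> has_vector_derivative frechet_derivative ?T (at (u + t *\<^sub>R w)) w) (at t within ?J)"
        using linear_scale[OF has_derivative_linear[OF T]]
        by (simp add: has_vector_derivative_def transition_def \<gamma>_def o_def)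
    qed
    qed
    ultimately show ?thesis unfolding C1_curve_def Let_def by auto
  qed
  then show "piecewise_C1_curve A \<gamma>" unfolding piecewise_C1_curve_def by (intro exI[of _ "{}"]) auto
  assume t: "t \<in> {0<..<1}"
  let ?F = "\<psi> \<circ> x"
  have T: "(?F has_derivative frechet_derivative ?F (at (u + t *\<^sub>R w))) (at (u + t *\<^sub>R w))"
    using V[of t] t by (intro smooth_on_has_derivative[OF chart(6)[OF Vx]]) auto
  have "((\<lambda>t. ?F (u + t *\<^sub>R w)) has_derivative (\<lambda>h. frechet_derivative ?F (at (u + t *\<^sub>R w)) (h *\<^sub>R w))) (at t)"
    by (rule has_derivative_compose[OF line T])
  then have "(\<psi> \<circ> \<gamma> has_vector_derivative frechet_derivative ?F (at (u + t *\<^sub>R w)) w) (at t)"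
    using linear_scale[OF has_derivative_linear[OF T]]
    by (simp add: has_vector_derivative_def \<gamma>_def o_def)
  from vector_derivative_at[OF this]
  show "speed \<gamma> t = sqrt (induced_metric (\<psi> \<circ> x) (u + t *\<^sub>R w) w w)"
    by (simp add: speed_def norm_sq_def induced_metric_def \<gamma>_def)
qed

section \<open>Comparison of the induced metric with the Euclidean metric of a chart\<close>

lemma curve_length_le:
  assumes P: "piecewise_C1_curve A \<gamma>" and M: "\<And>t. t \<in> {0<..<1} \<Longrightarrow> speed \<gamma> t \<le> M"
  shows "curve_length \<psi> \<gamma> \<le> M"
proof -
  have "(speed \<gamma> has_integral curve_length \<psi> \<gamma>) {0<..<1}"
    using curve_length_has_integral[OF P] has_integral_Icc_iff_Ioo by blast
  moreover have "((\<lambda>_. M) has_integral M) {0<..<1::real}"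
    using has_integral_const_real[of M 0 1] has_integral_Icc_iff_Ioo[of "\<lambda>_. M" M 0 1] by simp
  ultimately show ?thesis by (rule has_integral_le) (rule M)
qed

lemma chart_g_continuous:
  assumes Vx: "(V, x) \<in> A"
  shows "continuous_on V (\<lambda>u. induced_metric (\<psi> \<circ> x) u v w)"
  unfolding induced_metric_def
  by (intro continuous_on_steady_metric smooth_on_continuous[OF chart(6)[OF Vx]]
      smooth_on_continuous[OF smooth_on_directional[OF chart(6)[OF Vx]]])

text \<open>The induced metric has a positive minimum on the compact set of unit vectors over
  \<open>K\<close>; homogeneity extends the bound to all vectors.\<close>

lemma chart_g_lower_bound:
  assumes Vx: "(V, x) \<in> A" and K: "compact K" "K \<subseteq> V" "K \<noteq> {}"
  shows "\<exists>c>0. \<forall>u\<in>K. \<forall>v. c * norm v \<le> sqrt (induced_metric (\<psi> \<circ> x) u v v)"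
proof -
  let ?g = "induced_metric (\<psi> \<circ> x)" and ?S = "K \<times> sphere (0::real^2) 1"
  have c: "continuous_on ?S (\<lambda>p. ?g (fst p) (snd p) (snd p))"
    unfolding induced_metric_def using K(2)
    by (intro continuous_on_steady_metric continuous_on_smooth_derivative[OF chart(6)[OF Vx]]
        continuous_on_compose2[OF smooth_on_continuous[OF chart(6)[OF Vx]]] continuous_intros) auto
  have S: "compact ?S" "?S \<noteq> {}"
  proof -
    have "axis 1 1 \<in> sphere (0::real^2) 1" by simp
    then show "?S \<noteq> {}" using K by blast
  qed (use K in \<open>auto intro: compact_Times\<close>)
  from continuous_attains_inf[OF S c] obtain p where
    p: "p \<in> ?S" "\<And>q. q \<in> ?S \<Longrightarrow> ?g (fst p) (snd p) (snd p) \<le> ?g (fst q) (snd q) (snd q)"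
    by blast
  let ?m = "?g (fst p) (snd p) (snd p)"
  have "snd p \<noteq> 0" "fst p \<in> V" using p(1) K by auto
  then have m: "?m > 0" using chart_g_pos[OF Vx] by blast
  have "sqrt ?m * norm v \<le> sqrt (?g u v v)" if u: "u \<in> K" for u v
  proof (cases "v = 0")
    case True
    then show ?thesis using chart_g_nonneg[OF Vx, of u v] u K by auto
  next
    case False
    let ?w = "(1 / norm v) *\<^sub>R v"
    have lin: "linear (frechet_derivative (\<psi> \<circ> x) (at u))"
      using u K by (intro linear_frechet_derivative_smooth[OF chart(6)[OF Vx]]) auto
    have "?m \<le> ?g u ?w ?w" using p(2)[of "(u, ?w)"] u False by simp
    also have "\<dots> = ?g u v v / (norm v)\<^sup>2"
      by (simp add: induced_metric_def linear_scale[OF lin] steady_metric_simps power2_eq_square)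
    finally have "?m * (norm v)\<^sup>2 \<le> ?g u v v" using False by (simp add: field_simps)
    then have "sqrt (?m * (norm v)\<^sup>2) \<le> sqrt (?g u v v)" by simp
    then show ?thesis by (simp add: real_sqrt_mult)
  qed
  with m show ?thesis by (intro exI[of _ "sqrt ?m"]) auto
qed

end

subsection \<open>Ekeland's variational principle and the induced distance\<close>

text \<open>Ordering points by "y improves on x by at least \<epsilon> times their distance" gives a
  partial order; the conclusion is that \<open>x\<close> is maximal for it. A maximal element is
  found without Zorn's lemma, as the limit of a greedy sequence along which the possible gain is at
  most (1/2)^n.\<close>

lemma ekeland_variational_principle:
  fixes f :: "'a \<Rightarrow> real"
  assumes "Metric_space UNIV d" and complete: "Metric_space.mcomplete UNIV d"
    and bounded: "\<And>x. f x \<le> M"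
    and usc: "\<And>x e. e > 0 \<Longrightarrow> \<exists>\<delta>>0. \<forall>y. d x y < \<delta> \<longrightarrow> f y < f x + e"
    and \<epsilon>: "\<epsilon> > 0"
  shows "\<exists>x. f x0 \<le> f x \<and> (\<forall>y. f y \<le> f x + \<epsilon> * d x y)"
proof -
  interpret Metric_space UNIV d by fact
  \<comment> \<open>The points above \<open>x\<close> in this order; \<open>S_trans\<close> is its
    transitivity, that is, the triangle inequality.\<close>
  define S where "S x = {y. f x + \<epsilon> * d x y \<le> f y}" for x
  have pos: "0 \<le> \<epsilon> * d x y" for x y using \<epsilon> by simp
  have S_self: "x \<in> S x" for x by (simp add: S_def)
  have S_trans: "S y \<subseteq> S x" if "y \<in> S x" for x y
  proof
    fix z assume "z \<in> S y"
    have "\<epsilon> * d x z \<le> \<epsilon> * (d x y + d y z)" using \<epsilon> triangle[of x y z] by simp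
    then show "z \<in> S x" using that \<open>z \<in> S y\<close> by (simp add: S_def algebra_simps)
  qed
  have "\<exists>y\<in>S x. \<forall>z\<in>S x. f z \<le> f y + (1/2) ^ n" for x and n :: nat
  proof -
    have bdd: "bdd_above (f ` S x)" using bounded by (intro bdd_aboveI[of _ M]) auto
    have "Sup (f ` S x) - (1/2) ^ n < Sup (f ` S x)" by simp
    moreover have "f ` S x \<noteq> {}" using S_self by blast
    ultimately obtain y where y: "y \<in> S x" "Sup (f ` S x) - (1/2) ^ n < f y"
      using less_cSup_iff[OF _ bdd, of "Sup (f ` S x) - (1/2) ^ n"] by auto
    have "f z \<le> f y + (1/2) ^ n" if "z \<in> S x" for z
      using cSUP_upper[OF that bdd] y(2) by simp
    with y(1) show ?thesis by blast
  qed
  then obtain g where g: "\<And>x n. g x n \<in> S x" "\<And>x n z. z \<in> S x \<Longrightarrow> f z \<le> f (g x n) + (1/2) ^ n"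
    by metis
  define \<sigma> where "\<sigma> = rec_nat x0 (\<lambda>n x. g x n)"
  have \<sigma>: "\<sigma> 0 = x0" "\<sigma> (Suc n) = g (\<sigma> n) n" for n by (simp_all add: \<sigma>_def)
  have mono: "S (\<sigma> n) \<subseteq> S (\<sigma> m)" if "m \<le> n" for m n
    using that by (induction rule: dec_induct) (use S_trans g(1) \<sigma>(2) in \<open>metis order_trans order_refl\<close>)+
  have in_S: "\<sigma> n \<in> S (\<sigma> m)" if "m \<le> n" for m n using mono[OF that] S_self by blast
  have small: "\<epsilon> * d (\<sigma> m) (\<sigma> n) \<le> f (\<sigma> n) - f (\<sigma> m)" if "m \<le> n" for m n
    using in_S[OF that] by (simp add: S_def)
  \<comment> \<open>Points after \<open>\<sigma> (Suc k)\<close> still lie in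
    \<open>S (\<sigma> k)\<close>, where the greedy choice left a gain of at most
    \<open>(1/2) ^ k\<close>; in the order, gain controls distance.\<close>
  have tail: "\<epsilon> * d (\<sigma> (Suc k)) (\<sigma> n) \<le> (1/2) ^ k" if "Suc k \<le> n" for k n
    using small[OF that] g(2)[OF in_S[of k n], of k] that \<sigma>(2)[of k] by simp
  have "MCauchy \<sigma>"
    unfolding MCauchy_def
  proof (intro conjI allI impI)
    fix e :: real assume e: "e > 0"
    obtain k where k: "(1/2) ^ k < \<epsilon> * e / 2"
      using real_arch_pow_inv[of "\<epsilon> * e / 2" "1/2"] e \<epsilon> by auto
    have near: "d (\<sigma> (Suc k)) (\<sigma> n) < e / 2" if "Suc k \<le> n" for n
    proof -
      have "\<epsilon> * d (\<sigma> (Suc k)) (\<sigma> n) < \<epsilon> * (e / 2)" using tail[OF that] k by simp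
      then show ?thesis using \<epsilon> mult_less_cancel_left_pos by blast
    qed
    have "d (\<sigma> n) (\<sigma> n') < e" if "Suc k \<le> n" "Suc k \<le> n'" for n n'
      using near[OF that(1)] near[OF that(2)] triangle[of "\<sigma> n" "\<sigma> (Suc k)" "\<sigma> n'"]
        commute[of "\<sigma> n" "\<sigma> (Suc k)"] by simp
    then show "\<exists>N. \<forall>n n'. N \<le> n \<longrightarrow> N \<le> n' \<longrightarrow> d (\<sigma> n) (\<sigma> n') < e" by blast
  qed simp
  then obtain x where "limitin mtopology \<sigma> x sequentially" using complete mcomplete_def by blast
  then have lim: "\<exists>N. \<forall>n\<ge>N. d (\<sigma> n) x < e" if "e > 0" for e
    using that by (simp add: limit_metric_sequentially)
  \<comment> \<open>Upper semicontinuity makes the sets \<open>S\<close> closed under the limit.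
    Half of \<open>e\<close> pays for the value of \<open>f\<close>, half for the remaining
    distance.\<close>
  have x_in_S: "x \<in> S (\<sigma> m)" for m
  proof -
    have "f (\<sigma> m) + \<epsilon> * d (\<sigma> m) x \<le> f x + e" if e: "e > 0" for e
    proof -
      obtain \<delta> where \<delta>: "\<delta> > 0" "\<And>y. d x y < \<delta> \<Longrightarrow> f y < f x + e / 2" using usc[of "e / 2" x] e by auto
      obtain N where N: "\<And>n. n \<ge> N \<Longrightarrow> d (\<sigma> n) x < min \<delta> (e / (2 * \<epsilon>))"
        using lim[of "min \<delta> (e / (2 * \<epsilon>))"] \<delta>(1) e \<epsilon> by auto
      let ?n = "max N m"
      have n: "d (\<sigma> ?n) x < \<delta>" "d (\<sigma> ?n) x < e / (2 * \<epsilon>)" using N[of ?n] by auto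
      have "\<epsilon> * d (\<sigma> ?n) x < e / 2" using n(2) \<epsilon> by (simp add: field_simps)
      moreover have "\<epsilon> * d (\<sigma> m) x \<le> \<epsilon> * (d (\<sigma> m) (\<sigma> ?n) + d (\<sigma> ?n) x)"
        using \<epsilon> triangle[of "\<sigma> m" "\<sigma> ?n" x] by simp
      moreover have "f (\<sigma> ?n) < f x + e / 2" using n(1) by (intro \<delta>(2)) (simp add: commute)
      ultimately show ?thesis using small[of m ?n] by (simp add: distrib_left)
    qed
    then show ?thesis unfolding S_def using field_le_epsilon[of "f (\<sigma> m) + \<epsilon> * d (\<sigma> m) x" "f x"] by simp
  qed
  \<comment> \<open>A point violating the inequality would lie in every
    \<open>S (\<sigma> n)\<close>, so that the vanishing gains leave no room for
    \<open>f y > f x\<close>.\<close>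
  have "f y \<le> f x + \<epsilon> * d x y" for y
  proof (rule ccontr)
    assume y: "\<not> f y \<le> f x + \<epsilon> * d x y"
    then have "y \<in> S x" by (simp add: S_def)
    then have y_in: "y \<in> S (\<sigma> n)" for n using S_trans[OF x_in_S] by blast
    have "f y \<le> f (\<sigma> (Suc n)) + (1/2) ^ n" for n using g(2)[OF y_in] \<sigma>(2) by simp
    moreover have "f (\<sigma> n) \<le> f x" for n
      using x_in_S[of n] pos[of "\<sigma> n" x] by (simp add: S_def del: zero_le_mult_iff)
    ultimately have le: "f y \<le> f x + (1/2) ^ n" for n using add_right_mono order_trans by blast
    have "f y > f x" using y pos[of x y] by linarith
    then obtain n where "(1/2) ^ n < f y - f x" using real_arch_pow_inv[of "f y - f x" "1/2"] by auto
    then show False using le[of n] by simp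
  qed
  moreover have "f x0 \<le> f x"
    using x_in_S[of 0] \<sigma>(1) pos[of x0 x] by (simp add: S_def del: zero_le_mult_iff)
  ultimately show ?thesis by blast
qed

section \<open>Distance estimates from curves and chart balls\<close>

context spacelike_surface begin

abbreviation curves :: "'s \<Rightarrow> 's \<Rightarrow> (real \<Rightarrow> 's) set" where
  "curves p q \<equiv> {\<gamma>. piecewise_C1_curve A \<gamma> \<and> \<gamma> 0 = p \<and> \<gamma> 1 = q}"

abbreviation dist_\<psi> :: "'s \<Rightarrow> 's \<Rightarrow> real" where
  "dist_\<psi> \<equiv> induced_dist A \<psi>"

lemma induced_dist_le: "\<gamma> \<in> curves p q \<Longrightarrow> dist_\<psi> p q \<le> curve_length \<psi> \<gamma>"
  unfolding induced_dist_def
  by (rule cInf_lower) (auto intro!: bdd_belowI[of _ 0] curve_length_nonneg)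

text \<open>Existence of a joining curve is a genuine condition: the infimum of an empty set of
  reals carries no information.\<close>

lemma induced_dist_greatest:
  assumes "curves p q \<noteq> {}" "\<And>\<gamma>. \<gamma> \<in> curves p q \<Longrightarrow> c \<le> curve_length \<psi> \<gamma>"
  shows "c \<le> dist_\<psi> p q"
  unfolding induced_dist_def by (rule cInf_greatest) (use assms in auto)

lemma curves_reverse:
  assumes "\<gamma> \<in> curves p q"
  shows "(\<lambda>t. \<gamma> (1 - t)) \<in> curves q p" "curve_length \<psi> (\<lambda>t. \<gamma> (1 - t)) = curve_length \<psi> \<gamma>"
  using assms piecewise_reverse[of \<gamma>] by auto

lemma curves_join:
  assumes "\<gamma>1 \<in> curves p q" "\<gamma>2 \<in> curves q r"
  shows "\<exists>\<gamma>\<in>curves p r. curve_length \<psi> \<gamma> = curve_length \<psi> \<gamma>1 + curve_length \<psi> \<gamma>2"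
proof -
  let ?\<gamma> = "\<lambda>t::real. if t \<le> 1/2 then \<gamma>1 (2 * t) else \<gamma>2 (2 * t - 1)"
  have "piecewise_C1_curve A ?\<gamma>" "curve_length \<psi> ?\<gamma> = curve_length \<psi> \<gamma>1 + curve_length \<psi> \<gamma>2"
    using assms piecewise_join[of \<gamma>1 \<gamma>2] by auto
  then show ?thesis using assms by (intro bexI[of _ ?\<gamma>]) auto
qed

lemma straight_curve_mem:
  assumes Vx: "(V, x) \<in> A" and V: "\<And>t. t \<in> {0..1} \<Longrightarrow> u + t *\<^sub>R w \<in> V"
  shows "(\<lambda>t. x (u + t *\<^sub>R w)) \<in> curves (x u) (x (u + w))"
  using straight_curve(1)[OF Vx V] by simp

lemma ball_segment:
  fixes u w :: "'a::real_normed_vector"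
  assumes "w \<in> ball 0 r" "0 \<le> t" "t \<le> 1"
  shows "u + t *\<^sub>R w \<in> ball u r"
proof -
  have "t * norm w \<le> 1 * norm w" using assms by (intro mult_right_mono) auto
  then show ?thesis using assms by (simp add: dist_norm)
qed

lemma induced_dist_self: "dist_\<psi> p p = 0"
proof -
  obtain V x u where Vx: "(V, x) \<in> A" "u \<in> V" "x u = p" using chart_ex by blast
  \<comment> \<open>The constant curve, written as a degenerate coordinate segment so that its
    regularity comes from \<open>straight_curve\<close>.\<close>
  let ?\<gamma> = "\<lambda>t::real. x (u + t *\<^sub>R 0)"
  have \<gamma>: "?\<gamma> \<in> curves p p" using straight_curve_mem[OF Vx(1), of u 0] Vx by auto
  have "speed ?\<gamma> t \<le> 0" for t by (simp add: speed_def norm_sq_def steady_metric_def o_def)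
  then have "curve_length \<psi> ?\<gamma> \<le> 0" using \<gamma> by (intro curve_length_le) auto
  then have "dist_\<psi> p p \<le> 0" using induced_dist_le[OF \<gamma>] by simp
  moreover have "0 \<le> dist_\<psi> p p"
    using \<gamma> by (intro induced_dist_greatest) (auto intro: curve_length_nonneg)
  ultimately show ?thesis by simp
qed

text \<open>Up to its first exit time from the open coordinate ball the curve stays in one chart,
  and its coordinates travel the distance \<open>r\<close>. The rest of the curve contributes a
  nonnegative length.\<close>

lemma chart_exit_length:
  assumes Vx: "(V, x) \<in> A" and r: "r > 0" "cball u r \<subseteq> V"
    and c: "\<And>w v. w \<in> cball u r \<Longrightarrow> c * norm v \<le> sqrt (induced_metric (\<psi> \<circ> x) w v v)" "0 \<le> c"
    and \<gamma>: "\<gamma> \<in> curves (x u) q" and q: "q \<notin> x ` ball u r"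
  shows "c * r \<le> curve_length \<psi> \<gamma>"
proof -
  have P: "piecewise_C1_curve A \<gamma>" and ends: "\<gamma> 0 = x u" "\<gamma> 1 = q" using \<gamma> by auto
  have ballV: "ball u r \<subseteq> V" using r by auto
  note cont = piecewise_continuous[OF P]
  let ?S = "{0..1} \<inter> \<gamma> -` (- x ` ball u r)"
  have "closed ?S"
    by (rule continuous_closed_preimage[OF cont]) (auto intro: chart_open_image[OF Vx _ ballV])
  then have "compact ({0..1} \<inter> ?S)" by (intro compact_Int_closed) auto
  moreover have "{0..1} \<inter> ?S = ?S" by blast
  ultimately have "compact ?S" by simp
  moreover have "1 \<in> ?S" using ends q by simp
  then have "?S \<noteq> {}" by blast
  ultimately obtain T where T: "T \<in> ?S" "\<And>t. t \<in> ?S \<Longrightarrow> T \<le> t"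
    using compact_attains_inf[of ?S] by blast
  have "0 \<notin> ?S" using ends r(1) by auto
  then have T01: "0 < T" "T \<le> 1" using T(1) by (auto simp: order_less_le)
  have before: "\<gamma> t \<in> x ` ball u r" if "0 \<le> t" "t < T" for t
    using T(2)[of t] that T01 by force
  \<comment> \<open>The image of the closed ball is compact, hence closed in the Hausdorff surface.
    So the exit point is still covered by the chart, and its coordinates lie exactly on the sphere
    of radius \<open>r\<close>.\<close>
  let ?C = "{0..1} \<inter> \<gamma> -` (x ` cball u r)"
  have "closed ?C"
  proof (rule continuous_closed_preimage[OF cont])
    show "closed (x ` cball u r)"
      by (intro compact_imp_closed compact_continuous_image compact_cball continuous_on_subset[OF chart(3)[OF Vx] r(2)])
  qed simp
  moreover have "{0<..<T} \<subseteq> ?C"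
  proof
    fix t assume "t \<in> {0<..<T}"
    then show "t \<in> ?C" using before[of t] T01 ball_subset_cball[of u r] by auto
  qed
  ultimately have "closure {0<..<T} \<subseteq> ?C" by (rule closure_minimal[rotated])
  then have in_C: "{0..T} \<subseteq> ?C" using T01 by simp
  have "\<exists>I. (speed \<gamma> has_integral I) {0..T} \<and>
    c * norm (inv_into V x (\<gamma> T) - inv_into V x (\<gamma> 0)) \<le> I"
    by (rule length_in_chart[OF P Vx r(2) c]) (use T01 in_C in auto)
  then obtain I where I: "(speed \<gamma> has_integral I) {0..T}"
    "c * norm (inv_into V x (\<gamma> T) - inv_into V x (\<gamma> 0)) \<le> I" by blast
  have "T \<in> {0..T}" using T01 by simp
  then have "T \<in> ?C" using in_C by blast
  then obtain w where w: "w \<in> cball u r" "\<gamma> T = x w" by blast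
  have "w \<notin> ball u r" using T(1) w(2) by auto
  then have "norm (w - u) = r" using w(1) by (simp add: dist_norm norm_minus_commute)
  moreover have "u \<in> cball u r" using r(1) by simp
  then have "u \<in> V" "w \<in> V" using r(2) w(1) by blast+
  then have "inv_into V x (\<gamma> T) = w" "inv_into V x (\<gamma> 0) = u"
    using w(2) ends(1) chart_inv[OF Vx] by simp_all
  ultimately have le: "c * r \<le> I" using I(2) by simp
  show ?thesis
  proof (cases "T = 1")
    case True
    then show ?thesis using I(1) curve_length_has_integral[OF P] le has_integral_unique by blast
  next
    case False
    then obtain J where J: "J \<ge> 0" "(speed \<gamma> has_integral J) {T..1}"
      using piecewise_speed_has_integral[OF P, of T 1] T01 by auto
    have "(speed \<gamma> has_integral (I + J)) {0..1}" using has_integral_combine[OF _ _ I(1) J(2)] T01 by simp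
    then have "curve_length \<psi> \<gamma> = I + J" using curve_length_has_integral[OF P] has_integral_unique by blast
    then show ?thesis using le J(1) by simp
  qed
qed

end

locale connected_spacelike_surface = spacelike_surface A \<psi>
  for A :: "'s::{t2_space,second_countable_topology} atlas" and \<psi> +
  assumes connected: "connected (UNIV :: 's set)"
begin

text \<open>Joinability by curves is an equivalence relation, and coordinate segments make its
  classes open; a connected surface has only one class.\<close>

lemma curves_nonempty: "curves p q \<noteq> {}"
proof (rule connected_equivalence_relation[OF connected, of p q "\<lambda>p q. curves p q \<noteq> {}"])
  show "curves q p \<noteq> {}" if "curves p q \<noteq> {}" for p q using that curves_reverse(1) by blast
  show "curves p r \<noteq> {}" if "curves p q \<noteq> {}" "curves q r \<noteq> {}" for p q r
    using that curves_join[of _ p q _ r] by blast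
  show "\<exists>T. openin (top_of_set UNIV) T \<and> p \<in> T \<and> (\<forall>q\<in>T. curves p q \<noteq> {})" for p
  proof -
    obtain V x u where Vx: "(V, x) \<in> A" "u \<in> V" "x u = p" using chart_ex by blast
    obtain r where r: "r > 0" "ball u r \<subseteq> V" using chart(1)[OF Vx(1)] Vx(2) open_contains_ball by blast
    have "curves p (x w) \<noteq> {}" if w: "w \<in> ball u r" for w
    proof -
      have "u + t *\<^sub>R (w - u) \<in> V" if "t \<in> {0..1}" for t
        using ball_segment[of "w - u" r t u] w that r(2) by (auto simp: dist_norm norm_minus_commute)
      from straight_curve_mem[OF Vx(1) this]
      have "(\<lambda>t. x (u + t *\<^sub>R (w - u))) \<in> curves p (x w)" using Vx(3) by simp
      then show ?thesis by blast
    qed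
    moreover have "open (x ` ball u r)" using chart_open_image[OF Vx(1) _ r(2)] by simp
    moreover have "p \<in> x ` ball u r" using Vx(3) r(1) by force
    ultimately show ?thesis by (intro exI[of _ "x ` ball u r"]) auto
  qed
qed auto

lemma induced_dist_lower_bound:
  assumes Vx: "(V, x) \<in> A" and r: "r > 0" "cball u r \<subseteq> V"
  shows "\<exists>\<delta>>0. \<forall>q. dist_\<psi> (x u) q < \<delta> \<longrightarrow> q \<in> x ` ball u r"
proof -
  have "compact (cball u r)" "cball u r \<noteq> {}" using r by auto
  then obtain c where c: "c > 0" "\<And>w v. w \<in> cball u r \<Longrightarrow> c * norm v \<le> sqrt (induced_metric (\<psi> \<circ> x) w v v)"
    using chart_g_lower_bound[OF Vx _ r(2)] by blast
  have "c * r \<le> dist_\<psi> (x u) q" if "q \<notin> x ` ball u r" for q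
    using chart_exit_length[OF Vx r c(2) less_imp_le[OF c(1)] _ that]
    by (intro induced_dist_greatest curves_nonempty)
  then show ?thesis using c(1) r(1) by (intro exI[of _ "c * r"]) force
qed

text \<open>Every open set contains a distance ball around each of its points. Applied to the
  complement of a point, this gives definiteness of the distance.\<close>

lemma induced_dist_open:
  assumes "open U" "p \<in> U"
  shows "\<exists>\<delta>>0. \<forall>q. dist_\<psi> p q < \<delta> \<longrightarrow> q \<in> U"
proof -
  obtain V x u where Vx: "(V, x) \<in> A" "u \<in> V" "x u = p" using chart_ex by blast
  have "open (V \<inter> x -` U)" using continuous_open_preimage[OF chart(3,1)[OF Vx(1)] assms(1)] .
  moreover have "u \<in> V \<inter> x -` U" using Vx assms by simp
  ultimately obtain r where r: "r > 0" "cball u r \<subseteq> V \<inter> x -` U" using open_contains_cball by blast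
  then obtain \<delta> where "\<delta> > 0" "\<And>q. dist_\<psi> p q < \<delta> \<Longrightarrow> q \<in> x ` ball u r"
    using induced_dist_lower_bound[OF Vx(1), of r u] Vx(3) by auto
  moreover have "x ` ball u r \<subseteq> U" using r(2) ball_subset_cball[of u r] by blast
  ultimately show ?thesis by blast
qed

lemma induced_dist_metric: "Metric_space UNIV dist_\<psi>"
proof
  show nonneg: "0 \<le> dist_\<psi> p q" for p q
    by (intro induced_dist_greatest curves_nonempty) (auto intro: curve_length_nonneg)
  have le: "dist_\<psi> p q \<le> dist_\<psi> q p" for p q
  proof (intro induced_dist_greatest curves_nonempty)
    fix \<gamma> assume \<gamma>: "\<gamma> \<in> curves q p"
    show "dist_\<psi> p q \<le> curve_length \<psi> \<gamma>"
      using induced_dist_le[OF curves_reverse(1)[OF \<gamma>]] curves_reverse(2)[OF \<gamma>] by simp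
  qed
  show "dist_\<psi> p q = dist_\<psi> q p" for p q using le[of p q] le[of q p] by simp
  show "dist_\<psi> p q = 0 \<longleftrightarrow> p = q" for p q
  proof
    assume 0: "dist_\<psi> p q = 0"
    show "p = q"
    proof (rule ccontr)
      assume "p \<noteq> q"
      moreover have "open (- {q})" by (simp add: open_Compl)
      ultimately obtain \<delta> where \<delta>: "\<delta> > 0" "\<And>r. dist_\<psi> p r < \<delta> \<Longrightarrow> r \<in> - {q}"
        using induced_dist_open[of "- {q}" p] by blast
      show False using \<delta>(2)[of q] \<delta>(1) 0 by simp
    qed
  qed (simp add: induced_dist_self)
  show "dist_\<psi> p r \<le> dist_\<psi> p q + dist_\<psi> q r" for p q r
  proof -
    have "dist_\<psi> p r - curve_length \<psi> \<gamma>1 \<le> dist_\<psi> q r" if \<gamma>1: "\<gamma>1 \<in> curves p q" for \<gamma>1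
    proof (intro induced_dist_greatest curves_nonempty)
      fix \<gamma>2 assume "\<gamma>2 \<in> curves q r"
      then obtain \<gamma> where "\<gamma> \<in> curves p r" "curve_length \<psi> \<gamma> = curve_length \<psi> \<gamma>1 + curve_length \<psi> \<gamma>2"
        using curves_join[OF \<gamma>1] by blast
      then show "dist_\<psi> p r - curve_length \<psi> \<gamma>1 \<le> curve_length \<psi> \<gamma>2"
        using induced_dist_le[of \<gamma> p r] by simp
    qed
    then have "dist_\<psi> p r - dist_\<psi> q r \<le> curve_length \<psi> \<gamma>1" if "\<gamma>1 \<in> curves p q" for \<gamma>1
      using that by fastforce
    then have "dist_\<psi> p r - dist_\<psi> q r \<le> dist_\<psi> p q" by (intro induced_dist_greatest curves_nonempty)
    then show ?thesis by simp
  qed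
qed

text \<open>The segment from \<open>u\<close> to \<open>u + s *\<^sub>R v\<close> is short enough
  for the metric along it to be close to its value at \<open>u\<close>. An upper bound is the
  direction needed, because the distance enters Ekeland's inequality as a penalty on the larger
  side.\<close>

lemma induced_dist_infinitesimal:
  assumes Vx: "(V, x) \<in> A" and u: "u \<in> V" and \<eta>: "\<eta> > 0"
  shows "eventually (\<lambda>s. dist_\<psi> (x u) (x (u + s *\<^sub>R v))
     \<le> s * (sqrt (induced_metric (\<psi> \<circ> x) u v v) + \<eta>)) (at_right 0)"
proof -
  let ?q = "\<lambda>w. sqrt (induced_metric (\<psi> \<circ> x) w v v)"
  have "continuous_on V ?q" by (intro continuous_on_real_sqrt chart_g_continuous[OF Vx])
  then have "isCont ?q u" using chart(1)[OF Vx] u by (simp add: continuous_on_eq_continuous_at)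
  then obtain \<delta>1 where \<delta>1: "\<delta>1 > 0" "\<And>w. dist w u < \<delta>1 \<Longrightarrow> dist (?q w) (?q u) < \<eta>"
    using \<eta> unfolding continuous_at_eps_delta by blast
  obtain \<delta>2 where \<delta>2: "\<delta>2 > 0" "ball u \<delta>2 \<subseteq> V" using chart(1)[OF Vx] u open_contains_ball by blast
  define \<delta> where "\<delta> = min \<delta>1 \<delta>2"
  have \<delta>: "\<delta> > 0" "ball u \<delta> \<subseteq> V" "\<And>w. w \<in> ball u \<delta> \<Longrightarrow> ?q w \<le> ?q u + \<eta>"
    using \<delta>1 \<delta>2 by (auto simp: \<delta>_def dist_real_def dist_commute abs_less_iff intro: less_imp_le) fastforce
  \<comment> \<open>Dividing by \<open>norm v + 1\<close> keeps the segment inside the ball and also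
    covers \<open>v = 0\<close>.\<close>
  have main: "dist_\<psi> (x u) (x (u + s *\<^sub>R v)) \<le> s * (?q u + \<eta>)" if s: "0 < s" "s < \<delta> / (norm v + 1)" for s
  proof -
    have "s * norm v \<le> s * (norm v + 1)" using s by simp
    also have "\<dots> < \<delta>"
      using s(2) norm_ge_zero[of v] by (simp add: pos_less_divide_eq add_nonneg_pos)
    finally have "s *\<^sub>R v \<in> ball 0 \<delta>" using s by simp
    then have in_ball: "u + t *\<^sub>R (s *\<^sub>R v) \<in> ball u \<delta>" if "0 \<le> t" "t \<le> 1" for t
      using ball_segment that by blast
    have seg: "u + t *\<^sub>R (s *\<^sub>R v) \<in> V" if "t \<in> {0..1}" for t
      using in_ball[of t] that \<delta>(2) by auto
    let ?\<gamma> = "\<lambda>t. x (u + t *\<^sub>R (s *\<^sub>R v))"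
    have \<gamma>: "?\<gamma> \<in> curves (x u) (x (u + s *\<^sub>R v))" by (rule straight_curve_mem[OF Vx seg])
    have "curve_length \<psi> ?\<gamma> \<le> s * (?q u + \<eta>)"
    proof (rule curve_length_le)
      show "piecewise_C1_curve A ?\<gamma>" using \<gamma> by simp
      fix t :: real assume t: "t \<in> {0<..<1}"
      let ?w = "u + t *\<^sub>R (s *\<^sub>R v)"
      have lin: "linear (frechet_derivative (\<psi> \<circ> x) (at ?w))"
        using seg[of t] t by (intro linear_frechet_derivative_smooth[OF chart(6)[OF Vx]]) auto
      have "speed ?\<gamma> t = sqrt (induced_metric (\<psi> \<circ> x) ?w (s *\<^sub>R v) (s *\<^sub>R v))"
        by (rule straight_curve(2)[OF Vx seg t])
      also have "\<dots> = sqrt (s\<^sup>2 * induced_metric (\<psi> \<circ> x) ?w v v)"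
        unfolding induced_metric_def linear_scale[OF lin, of s v] by (simp add: steady_metric_simps power2_eq_square)
      also have "\<dots> = s * ?q ?w" using s by (simp add: real_sqrt_mult)
      also have "\<dots> \<le> s * (?q u + \<eta>)" using s \<delta>(3)[OF in_ball[of t]] t by (intro mult_left_mono) auto
      finally show "speed ?\<gamma> t \<le> s * (?q u + \<eta>)" .
    qed
    then show ?thesis using induced_dist_le[OF \<gamma>] by simp
  qed
  show ?thesis unfolding eventually_at_right_field
    by (rule exI[of _ "\<delta> / (norm v + 1)"]) (use main \<delta>(1) in \<open>auto intro!: divide_pos_pos add_nonneg_pos\<close>)
qed

text \<open>Ekeland's principle in infinitesimal form.\<close>

lemma almost_maximum_small_slope:
  fixes f :: "'s \<Rightarrow> real"
  assumes complete: "complete_immersion A \<psi>"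
    and bounded: "\<And>p. f p \<le> M"
    and diff: "\<And>V x u. (V, x) \<in> A \<Longrightarrow> u \<in> V \<Longrightarrow> ((\<lambda>w. f (x w)) has_derivative f' V x u) (at u)"
    and \<epsilon>: "\<epsilon> > 0"
  shows "\<exists>V x u. (V, x) \<in> A \<and> u \<in> V \<and> f b \<le> f (x u) \<and>
    (\<forall>v. f' V x u v \<le> \<epsilon> * sqrt (induced_metric (\<psi> \<circ> x) u v v))"
proof -
  \<comment> \<open>Continuity in a chart gives a coordinate ball on which \<open>f\<close> stays
    below \<open>f p + e\<close>, and \<open>induced_dist_lower_bound\<close> places a distance ball
    inside its image.\<close>
  have usc: "\<exists>\<delta>>0. \<forall>q. dist_\<psi> p q < \<delta> \<longrightarrow> f q < f p + e" if e: "e > 0" for p e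
  proof -
    obtain V x u where Vx: "(V, x) \<in> A" "u \<in> V" "x u = p" using chart_ex by blast
    have "isCont (\<lambda>w. f (x w)) u" using diff[OF Vx(1,2)] has_derivative_continuous by blast
    then obtain r1 where r1: "r1 > 0" "\<And>w. dist w u < r1 \<Longrightarrow> dist (f (x w)) (f (x u)) < e"
      using e unfolding continuous_at_eps_delta by blast
    obtain r2 where r2: "r2 > 0" "cball u r2 \<subseteq> V" using chart(1)[OF Vx(1)] Vx(2) open_contains_cball by blast
    let ?r = "min r1 r2"
    have "?r > 0" "cball u ?r \<subseteq> V" using r1(1) r2 by auto
    then obtain \<delta> where \<delta>: "\<delta> > 0" "\<And>q. dist_\<psi> (x u) q < \<delta> \<Longrightarrow> q \<in> x ` ball u ?r"
      using induced_dist_lower_bound[OF Vx(1)] by blast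
    have "f q < f p + e" if dq: "dist_\<psi> p q < \<delta>" for q
    proof -
      have "q \<in> x ` ball u ?r" using \<delta>(2) Vx(3) dq by simp
      then obtain w where "w \<in> ball u ?r" "q = x w" by blast
      then show ?thesis using r1(2)[of w] Vx(3) by (simp add: dist_commute dist_real_def abs_less_iff)
    qed
    with \<delta>(1) show ?thesis by blast
  qed
  obtain p where p: "f b \<le> f p" "\<And>q. f q \<le> f p + \<epsilon> * dist_\<psi> p q"
    using ekeland_variational_principle[OF induced_dist_metric complete[unfolded complete_immersion_def] bounded usc \<epsilon>]
    by blast
  obtain V x u where Vx: "(V, x) \<in> A" "u \<in> V" "x u = p" using chart_ex by blast
  have *: "f' V x u v \<le> \<epsilon> * (sqrt (induced_metric (\<psi> \<circ> x) u v v) + \<eta>)" if \<eta>: "\<eta> > 0" for v \<eta>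
  proof -
    let ?M = "sqrt (induced_metric (\<psi> \<circ> x) u v v) + \<eta>"
    have line: "((\<lambda>s. u + s *\<^sub>R v) has_derivative (\<lambda>h. h *\<^sub>R v)) (at 0)"
      by (auto intro!: derivative_eq_intros)
    have D: "((\<lambda>w. f (x w)) has_derivative f' V x u) (at (u + 0 *\<^sub>R v))" using diff[OF Vx(1,2)] by simp
    have "((\<lambda>s. f (x (u + s *\<^sub>R v))) has_derivative (\<lambda>h. f' V x u (h *\<^sub>R v))) (at 0)"
      by (rule has_derivative_compose[OF line D])
    moreover have "f' V x u (h *\<^sub>R v) = f' V x u v * h" for h
      using linear_scale[OF has_derivative_linear[OF D]] by simp
    ultimately have "((\<lambda>s. f (x (u + s *\<^sub>R v))) has_real_derivative f' V x u v) (at 0)"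
      by (simp add: has_field_derivative_def mult_commute_abs)
    then have "((\<lambda>s. (f (x (u + s *\<^sub>R v)) - f (x u)) / s) \<longlongrightarrow> f' V x u v) (at 0)"
      by (simp add: DERIV_def)
    then have lim: "((\<lambda>s. (f (x (u + s *\<^sub>R v)) - f (x u)) / s) \<longlongrightarrow> f' V x u v) (at_right 0)"
      by (rule filterlim_mono[OF _ order_refl at_le]) simp
    \<comment> \<open>Ekeland's inequality with the distance replaced by its first-order upper
      bound; dividing by \<open>s > 0\<close> bounds the difference quotient, hence the one-sided
      limit.\<close>
    have "eventually (\<lambda>s. (f (x (u + s *\<^sub>R v)) - f (x u)) / s \<le> \<epsilon> * ?M) (at_right 0)"
      using induced_dist_infinitesimal[OF Vx(1,2) \<eta>, of v] eventually_at_right_less[of 0]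
    proof eventually_elim
      case (elim s)
      have "f (x (u + s *\<^sub>R v)) - f (x u) \<le> \<epsilon> * dist_\<psi> (x u) (x (u + s *\<^sub>R v))"
        using p(2)[of "x (u + s *\<^sub>R v)"] Vx(3) by simp
      also have "\<dots> \<le> \<epsilon> * (s * ?M)" using elim(1) \<epsilon> by (intro mult_left_mono) auto
      finally show ?case using elim(2) by (simp add: pos_divide_le_eq mult_ac)
    qed
    then show ?thesis by (intro tendsto_upperbound[OF lim]) auto
  qed
  have "f' V x u v \<le> \<epsilon> * sqrt (induced_metric (\<psi> \<circ> x) u v v)" for v
  proof (rule field_le_epsilon)
    fix e :: real assume e: "e > 0"
    show "f' V x u v \<le> \<epsilon> * sqrt (induced_metric (\<psi> \<circ> x) u v v) + e"
      using *[of "e / \<epsilon>" v] e \<epsilon> by (simp add: distrib_left)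
  qed
  with Vx p(1) show ?thesis by blast
qed

end

subsection \<open>Local theory of spacelike surfaces\<close>

text \<open>A single chart together with the pulled-back immersion and normal. The geometry up to
  the gradient estimate is local and needs no atlas.\<close>

locale spacelike_patch =
  fixes V :: "(real^2) set" and F n :: "real^2 \<Rightarrow> steady_state"
  assumes open_V: "open V"
    and smooth_F: "smooth_on V F"
    and smooth_n: "smooth_on V n"
    and spacelike: "u \<in> V \<Longrightarrow> v \<noteq> 0 \<Longrightarrow> induced_metric F u v v > 0"
    and unit_n: "u \<in> V \<Longrightarrow> steady_metric (F u) (n u) (n u) = -1"
    and future_n: "u \<in> V \<Longrightarrow> steady_metric (F u) (n u) del_t < 0"
    and normal_n: "u \<in> V \<Longrightarrow> steady_metric (F u) (n u) (frechet_derivative F (at u) v) = 0"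
begin

abbreviation D :: "real^2 \<Rightarrow> real^2 \<Rightarrow> steady_state" where
  "D u v \<equiv> frechet_derivative F (at u) v"

abbreviation g :: "(real^2) metric_form" where
  "g \<equiv> induced_metric F"

abbreviation cov :: "(real^2 \<Rightarrow> steady_state) \<Rightarrow> real^2 \<Rightarrow> real^2 \<Rightarrow> steady_state" where
  "cov Y u v \<equiv> cov_deriv steady_metric F Y u v"

text \<open>The ambient derivative of the coordinate field \<open>w\<close> in direction
  \<open>v\<close>, with both its tangential and its normal part.\<close>

abbreviation B :: "real^2 \<Rightarrow> real^2 \<Rightarrow> real^2 \<Rightarrow> steady_state" where
  "B u v w \<equiv> cov (\<lambda>q. D q w) u v"

text \<open>The second fundamental form. Since \<open>n\<close> has square -1, this sign makes
  \<open>L\<close> the coefficient of \<open>n\<close> in \<open>B\<close>.\<close>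

abbreviation L :: "real^2 \<Rightarrow> real^2 \<Rightarrow> real^2 \<Rightarrow> real" where
  "L u v w \<equiv> - steady_metric (F u) (B u v w) (n u)"

section \<open>Linear algebra of the tangent plane\<close>

lemma linear_D: "u \<in> V \<Longrightarrow> linear (frechet_derivative F (at u))"
  using linear_frechet_derivative_smooth smooth_F by blast

lemma smooth_D: "smooth_on V (\<lambda>q. D q w)"
  using smooth_F smooth_on_directional by blast

lemma D_simps:
  assumes "u \<in> V"
  shows "D u (v + w) = D u v + D u w" "D u (v - w) = D u v - D u w" "D u (c *\<^sub>R v) = c *\<^sub>R D u v"
    "D u (- v) = - D u v" "D u 0 = 0"
  using linear_D[OF assms] by (simp_all add: linear_add linear_diff linear_scale linear_neg linear_0)

lemma g_simps:
  assumes "u \<in> V"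
  shows "g u (v + w) z = g u v z + g u w z" "g u z (v + w) = g u z v + g u z w"
    "g u (v - w) z = g u v z - g u w z" "g u z (v - w) = g u z v - g u z w"
    "g u (c *\<^sub>R v) z = c * g u v z" "g u z (c *\<^sub>R v) = c * g u z v"
    "g u (- v) z = - g u v z" "g u z (- v) = - g u z v" "g u 0 z = 0" "g u z 0 = 0"
  unfolding induced_metric_def by (simp_all add: D_simps[OF assms] steady_metric_simps)

lemma g_commute: "g u v w = g u w v"
  by (simp add: induced_metric_def steady_metric_commute)

lemma g_nonneg: "u \<in> V \<Longrightarrow> 0 \<le> g u v v"
  using spacelike[of u v] by (cases "v = 0") (auto simp: g_simps)

lemma g_eq_D: "g u v w = steady_metric (F u) (D u v) (D u w)"
  by (simp add: induced_metric_def)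

lemma g_nondegenerate:
  assumes "u \<in> V" "\<And>z. g u v z = g u w z"
  shows "v = w"
proof (rule ccontr)
  assume "v \<noteq> w"
  then have "g u (v - w) (v - w) > 0" using spacelike assms(1) by simp
  moreover have "g u (v - w) (v - w) = 0" using assms by (simp add: g_simps)
  ultimately show False by simp
qed

lemma fst_n_pos: "u \<in> V \<Longrightarrow> fst (n u) > 0"
  using future_n[of u] by (simp add: steady_metric_def del_t_def)

text \<open>As \<open>fst (n u)\<close> is nonzero, orthogonality to \<open>n u\<close> determines
  the time component from the horizontal one.\<close>

lemma tangent_eqI:
  assumes "u \<in> V" "steady_metric (F u) (n u) X = 0" "steady_metric (F u) (n u) Y = 0" "snd X = snd Y"
  shows "X = Y"
  using assms fst_n_pos[of u] by (intro prod_eqI) (auto simp: steady_metric_def)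

lemma inj_D:
  assumes "u \<in> V" "D u v = D u w" shows "v = w"
  using g_nondegenerate[OF assms(1), of v w] assms(2) by (simp add: g_eq_D)

text \<open>A nonzero tangent vector without horizontal part would not be spacelike, so the
  horizontal projection of the tangent plane is injective, and by dimension surjective.\<close>

lemma ex_snd_D:
  assumes "u \<in> V"
  shows "\<exists>v. snd (D u v) = y"
proof -
  let ?P = "\<lambda>v. snd (D u v)"
  have lin: "linear ?P"
    by (rule linearI) (simp_all add: D_simps[OF assms])
  have "v = 0" if "?P v = 0" for v
  proof (rule ccontr)
    assume "v \<noteq> 0"
    then have "g u v v > 0" using spacelike assms by blast
    moreover have "g u v v = - (fst (D u v))\<^sup>2"
      using that by (simp add: g_eq_D steady_metric_def power2_eq_square)
    ultimately show False by simp
  qed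
  then have "inj ?P" using linear_injective_0[OF lin] by blast
  then have "surj ?P" using linear_injective_imp_surjective[OF lin] by blast
  then obtain v where "y = ?P v" by (rule surjE)
  then show ?thesis by blast
qed

lemma tangent_ex:
  assumes "u \<in> V" "steady_metric (F u) (n u) X = 0"
  shows "\<exists>v. D u v = X"
proof -
  obtain v where "snd (D u v) = snd X" using ex_snd_D[OF assms(1)] by blast
  then have "D u v = X" using assms normal_n by (intro tangent_eqI) auto
  then show ?thesis by blast
qed

text \<open>Vanishing torsion: coordinate fields commute, and the Christoffel term is
  symmetric.\<close>

lemma B_commute:
  assumes "u \<in> V" shows "B u v w = B u w v"
  using mixed_derivatives_commute[OF open_V assms smooth_F, of v w]
  by (simp add: cov_deriv_steady inner_commute add.commute)

section \<open>The Gauss formula and the regularity of tangent fields\<close>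

lemma D_coords: "u \<in> V \<Longrightarrow> D u v = v $ 1 *\<^sub>R D u (axis 1 1) + v $ 2 *\<^sub>R D u (axis 2 1)"
  by (rule linear_coords_2) (rule linear_D)

text \<open>The Leibniz rule for a tangent field with variable coordinates. Smoothness controls
  \<open>D\<close> only in fixed directions, hence the expansion in the two coordinate
  fields.\<close>

lemma cov_D_field:
  assumes u: "u \<in> V" and \<gamma>: "\<gamma> differentiable at u"
  shows "cov (\<lambda>q. D q (\<gamma> q)) u a = D u (frechet_derivative \<gamma> (at u) a) + B u a (\<gamma> u)"
    and "(\<lambda>q. D q (\<gamma> q)) differentiable at u"
proof -
  let ?D2 = "\<lambda>w. frechet_derivative (\<lambda>q. D q w) (at u)"
  have D2: "((\<lambda>q. D q w) has_derivative ?D2 w) (at u)" for w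
    by (rule smooth_on_has_derivative[OF smooth_D u])
  have \<gamma>D: "(\<gamma> has_derivative frechet_derivative \<gamma> (at u)) (at u)"
    using \<gamma> frechet_derivative_works by blast
  have comp: "((\<lambda>q. \<gamma> q $ i) has_derivative (\<lambda>a. frechet_derivative \<gamma> (at u) a $ i)) (at u)" for i
    by (rule bounded_linear.has_derivative[OF bounded_linear_vec_nth \<gamma>D])
  have *: "((\<lambda>q. \<alpha> q *\<^sub>R D q (axis 1 1) + \<beta> q *\<^sub>R D q (axis 2 1)) has_derivative
       (\<lambda>a. \<alpha> u *\<^sub>R ?D2 (axis 1 1) a + \<alpha>' a *\<^sub>R D u (axis 1 1)
          + (\<beta> u *\<^sub>R ?D2 (axis 2 1) a + \<beta>' a *\<^sub>R D u (axis 2 1)))) (at u)"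
    if "(\<alpha> has_derivative \<alpha>') (at u)" "(\<beta> has_derivative \<beta>') (at u)" for \<alpha> \<beta> \<alpha>' \<beta>'
    by (intro has_derivative_add has_derivative_scaleR that D2)
  have 1: "((\<lambda>q. D q (\<gamma> q)) has_derivative
       (\<lambda>a. \<gamma> u $ 1 *\<^sub>R ?D2 (axis 1 1) a + (frechet_derivative \<gamma> (at u) a $ 1) *\<^sub>R D u (axis 1 1)
          + (\<gamma> u $ 2 *\<^sub>R ?D2 (axis 2 1) a + (frechet_derivative \<gamma> (at u) a $ 2) *\<^sub>R D u (axis 2 1)))) (at u)"
    by (rule has_derivative_transform_within_open[OF *[OF comp comp] open_V u])
      (erule D_coords[symmetric])
  \<comment> \<open>The same field with coordinates frozen at \<open>u\<close>; its derivative is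
    the part that enters \<open>B\<close>.\<close>
  have 2: "((\<lambda>q. D q (\<gamma> u)) has_derivative
       (\<lambda>a. \<gamma> u $ 1 *\<^sub>R ?D2 (axis 1 1) a + 0 *\<^sub>R D u (axis 1 1)
          + (\<gamma> u $ 2 *\<^sub>R ?D2 (axis 2 1) a + 0 *\<^sub>R D u (axis 2 1)))) (at u)"
    by (rule has_derivative_transform_within_open[OF *[OF has_derivative_const has_derivative_const] open_V u])
      (erule D_coords[symmetric])
  show "(\<lambda>q. D q (\<gamma> q)) differentiable at u" using 1 differentiable_def by blast
  have "frechet_derivative (\<lambda>q. D q (\<gamma> q)) (at u) a
    = D u (frechet_derivative \<gamma> (at u) a) + ?D2 (\<gamma> u) a"
    unfolding frechet_derivative_at[OF 1, symmetric] frechet_derivative_at[OF 2, symmetric]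
    by (subst D_coords[OF u]) simp
  then show "cov (\<lambda>q. D q (\<gamma> q)) u a = D u (frechet_derivative \<gamma> (at u) a) + B u a (\<gamma> u)"
    by (simp add: cov_deriv_steady)
qed

lemma metric_g_derivative:
  assumes "u \<in> V"
  shows "frechet_derivative (\<lambda>q. g q v w) (at u) z
     = steady_metric (F u) (B u z v) (D u w) + steady_metric (F u) (B u z w) (D u v)"
proof -
  have "((\<lambda>q. g q v w) has_derivative (\<lambda>z.
      steady_metric (F u) (B u z v) (D u w) + steady_metric (F u) (D u v) (B u z w))) (at u)"
    unfolding g_eq_D
    by (intro steady_metric_compatible smooth_on_differentiable[OF smooth_F assms]
        smooth_on_differentiable[OF smooth_D assms])
  from frechet_derivative_at[OF this, symmetric] show ?thesis
    by (simp add: steady_metric_commute)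
qed

text \<open>The Gauss formula: the intrinsic derivative is the tangential part of the ambient one.
  By metric compatibility and symmetry of \<open>B\<close>, that tangential part satisfies the
  Koszul identity of the induced metric, whose solution is unique.\<close>

lemma D_christoffel:
  assumes u: "u \<in> V"
  shows "D u (christoffel g u v w) = B u v w - L u v w *\<^sub>R n u"
proof -
  have "steady_metric (F u) (n u) (B u v w - L u v w *\<^sub>R n u) = 0"
    using unit_n[OF u] by (simp add: steady_metric_simps steady_metric_commute)
  then obtain \<gamma> where \<gamma>: "D u \<gamma> = B u v w - L u v w *\<^sub>R n u" using tangent_ex u by blast
  have g\<gamma>: "g u \<gamma> z = steady_metric (F u) (B u v w) (D u z)" for z
    by (simp add: g_eq_D \<gamma> steady_metric_simps normal_n[OF u])
  have koszul: "frechet_derivative (\<lambda>q. g q w z) (at u) v + frechet_derivative (\<lambda>q. g q v z) (at u) w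
      - frechet_derivative (\<lambda>q. g q v w) (at u) z = 2 * g u \<gamma> z" for z
    unfolding metric_g_derivative[OF u] g\<gamma>
    using B_commute[OF u, of w v] B_commute[OF u, of z v] B_commute[OF u, of z w] by simp
  have "christoffel g u v w = \<gamma>" unfolding christoffel_def koszul
  proof (rule the_equality)
    fix z assume "\<forall>w. 2 * g u z w = 2 * g u \<gamma> w"
    then show "z = \<gamma>" by (intro g_nondegenerate[OF u]) simp
  qed simp
  with \<gamma> show ?thesis by simp
qed

definition gram :: "real^2 \<Rightarrow> real" where
  "gram u = g u (axis 1 1) (axis 1 1) * g u (axis 2 1) (axis 2 1) - (g u (axis 1 1) (axis 2 1))\<^sup>2"

lemma gram_pos:
  assumes q: "q \<in> V" shows "gram q > 0"
proof -
  let ?e = "\<lambda>i. axis i 1 :: real^2"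
  let ?E = "\<lambda>q. g q (?e 1) (?e 1)" and ?F = "\<lambda>q. g q (?e 1) (?e 2)" and ?G = "\<lambda>q. g q (?e 2) (?e 2)"
  have E: "?E q > 0" using spacelike[OF q, of "?e 1"] by (simp add: axis_eq_0_iff)
  \<comment> \<open>The second Gram-Schmidt vector, scaled to avoid a division; its square is
    \<open>?E q * gram q\<close>.\<close>
  have "?E q *\<^sub>R ?e 2 - ?F q *\<^sub>R ?e 1 \<noteq> 0"
  proof
    assume "?E q *\<^sub>R ?e 2 - ?F q *\<^sub>R ?e 1 = 0"
    then have "(?E q *\<^sub>R ?e 2 - ?F q *\<^sub>R ?e 1) $ 2 = 0" by simp
    then show False using E by (simp add: axis_def)
  qed
  then have "g q (?E q *\<^sub>R ?e 2 - ?F q *\<^sub>R ?e 1) (?E q *\<^sub>R ?e 2 - ?F q *\<^sub>R ?e 1) > 0"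
    using spacelike q by blast
  also have "g q (?E q *\<^sub>R ?e 2 - ?F q *\<^sub>R ?e 1) (?E q *\<^sub>R ?e 2 - ?F q *\<^sub>R ?e 1) = ?E q * gram q"
    using g_commute[of q "?e 2" "?e 1"] by (simp add: g_simps[OF q] gram_def power2_eq_square algebra_simps)
  finally show ?thesis using E by (simp add: zero_less_mult_iff)
qed

text \<open>By Cramer's rule.\<close>

lemma differentiable_of_D_differentiable:
  assumes u: "u \<in> V" and T: "(\<lambda>q. T q) differentiable at u" and eq: "\<And>q. q \<in> V \<Longrightarrow> D q (\<gamma> q) = T q"
  shows "\<gamma> differentiable at u"
proof -
  let ?e = "\<lambda>i. axis i 1 :: real^2"
  let ?E = "\<lambda>q. g q (?e 1) (?e 1)" and ?F = "\<lambda>q. g q (?e 1) (?e 2)" and ?G = "\<lambda>q. g q (?e 2) (?e 2)"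
  let ?t = "\<lambda>i q. steady_metric (F q) (T q) (D q (?e i))"
  let ?\<Delta> = "\<lambda>q. ?E q * ?G q - ?F q * ?F q"
  let ?r = "\<lambda>q. ((?t 1 q * ?G q - ?t 2 q * ?F q) / ?\<Delta> q) *\<^sub>R ?e 1 + ((?t 2 q * ?E q - ?t 1 q * ?F q) / ?\<Delta> q) *\<^sub>R ?e 2"
  have \<Delta>: "?\<Delta> q > 0" if "q \<in> V" for q
    using gram_pos[OF that] by (simp add: gram_def power2_eq_square)
  have r: "?r q = \<gamma> q" if q: "q \<in> V" for q
  proof -
    have \<gamma>: "\<gamma> q = \<gamma> q $ 1 *\<^sub>R ?e 1 + \<gamma> q $ 2 *\<^sub>R ?e 2"
      by (simp add: vec_eq_iff forall_2 axis_def)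
    have t: "?t i q = \<gamma> q $ 1 * g q (?e 1) (?e i) + \<gamma> q $ 2 * g q (?e 2) (?e i)" for i
    proof -
      have "?t i q = g q (\<gamma> q) (?e i)" using eq[OF q] by (simp add: g_eq_D)
      then show ?thesis by (subst (asm) \<gamma>) (simp add: g_simps[OF q])
    qed
    have "(?t 1 q * ?G q - ?t 2 q * ?F q) / ?\<Delta> q = \<gamma> q $ 1"
      using \<Delta>[OF q] unfolding t g_commute[of q "?e 2" "?e 1"] by (simp add: field_simps)
    moreover have "(?t 2 q * ?E q - ?t 1 q * ?F q) / ?\<Delta> q = \<gamma> q $ 2"
      using \<Delta>[OF q] unfolding t g_commute[of q "?e 2" "?e 1"] by (simp add: field_simps)
    ultimately show ?thesis using \<gamma> by simp
  qed
  note dF = smooth_on_differentiable[OF smooth_F u] smooth_on_differentiable[OF smooth_D u]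
  have sm: "(\<lambda>q. steady_metric (F q) (X q) (Y q)) differentiable at u"
    if "X differentiable at u" "Y differentiable at u" for X Y
    using steady_metric_compatible[OF dF(1) that] differentiable_def by blast
  have dg: "(\<lambda>q. g q v w) differentiable at u" for v w
    unfolding g_eq_D by (intro sm dF)
  have "?r differentiable at u"
    using \<Delta>[OF u] by (intro differentiable_add differentiable_scaleR differentiable_divide differentiable_diff
        differentiable_mult differentiable_const sm dg dF T) auto
  then show ?thesis
    using r open_V u unfolding differentiable_def
    by (meson has_derivative_transform_within_open)
qed

section \<open>The Weingarten and Gauss equations\<close>

lemma cov_cong:
  assumes "u \<in> V" "\<And>q. q \<in> V \<Longrightarrow> Y q = Z q"
  shows "cov Y u a = cov Z u a"
  using frechet_derivative_cong_open[OF open_V assms(1), of Y Z] assms by (simp add: cov_deriv_def)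

lemma cov_diff_scaleR:
  assumes "Y differentiable at u" "Z differentiable at u" "f differentiable at u"
  shows "cov (\<lambda>q. Y q - f q *\<^sub>R Z q) u a
    = cov Y u a - f u *\<^sub>R cov Z u a - frechet_derivative f (at u) a *\<^sub>R Z u"
proof -
  have "((\<lambda>q. Y q - f q *\<^sub>R Z q) has_derivative (\<lambda>a. frechet_derivative Y (at u) a -
     (f u *\<^sub>R frechet_derivative Z (at u) a + frechet_derivative f (at u) a *\<^sub>R Z u))) (at u)"
    using assms unfolding frechet_derivative_works
    by (intro has_derivative_diff has_derivative_scaleR)
  from frechet_derivative_at[OF this, symmetric] show ?thesis
    by (simp add: cov_deriv_steady algebra_simps prod_eq_iff)
qed

lemma differentiable_patch:
  assumes "u \<in> V"
  shows "F differentiable at u" "n differentiable at u" "(\<lambda>q. D q w) differentiable at u"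
    "(\<lambda>q. B q v w) differentiable at u" "(\<lambda>q. L q v w) differentiable at u"
proof -
  show 1: "F differentiable at u" "n differentiable at u" "(\<lambda>q. D q w) differentiable at u"
    using smooth_on_differentiable assms smooth_F smooth_n smooth_D by blast+
  show 2: "(\<lambda>q. B q v w) differentiable at u"
    by (rule cov_deriv_steady_differentiable[OF open_V assms smooth_F smooth_D])
  have "(\<lambda>q. steady_metric (F q) (B q v w) (n q)) differentiable at u"
    using steady_metric_compatible[OF 1(1) 2 1(2)] differentiable_def by blast
  then show "(\<lambda>q. L q v w) differentiable at u" by (rule differentiable_minus)
qed

text \<open>Differentiate the orthogonality of \<open>n\<close> to the coordinate field
  \<open>z\<close>.\<close>

lemma weingarten:
  assumes u: "u \<in> V"
  shows "steady_metric (F u) (cov n u a) (D u z) = L u a z"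
proof -
  note d = differentiable_patch[OF u]
  from steady_metric_compatible[OF d(1,2) d(3)]
  have "((\<lambda>q. 0) has_derivative (\<lambda>a. steady_metric (F u) (cov n u a) (D u z)
      + steady_metric (F u) (n u) (B u a z))) (at u)"
    by (rule has_derivative_transform_within_open[OF _ open_V u]) (rule normal_n)
  from fun_cong[OF has_derivative_unique[OF this has_derivative_const], of a]
  show ?thesis by (simp add: steady_metric_commute)
qed

text \<open>Differentiate the constant square of \<open>n\<close>.\<close>

lemma cov_n_tangent:
  assumes u: "u \<in> V"
  shows "steady_metric (F u) (n u) (cov n u a) = 0"
proof -
  note d = differentiable_patch[OF u]
  from steady_metric_compatible[OF d(1,2,2)]
  have "((\<lambda>q. -1) has_derivative (\<lambda>a. steady_metric (F u) (cov n u a) (n u)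
      + steady_metric (F u) (n u) (cov n u a))) (at u)"
    by (rule has_derivative_transform_within_open[OF _ open_V u]) (rule unit_n)
  from fun_cong[OF has_derivative_unique[OF this has_derivative_const], of a]
  show ?thesis by (simp add: steady_metric_commute)
qed

text \<open>Two uses of the Gauss formula: the outer derivative acts on the tangential field
  \<open>B - L n\<close>. Multiples of \<open>n\<close> vanish against \<open>D u z\<close>, while
  the derivative of \<open>n\<close> inside \<open>L n\<close> gives the product of second
  fundamental forms by Weingarten.\<close>

lemma tangential_second_derivative:
  assumes u: "u \<in> V"
  shows "g u (cov_deriv g (\<lambda>q. q) (\<lambda>q. christoffel g q v w) u a) z
    = steady_metric (F u) (cov (\<lambda>q. B q v w) u a) (D u z) - L u v w * L u a z"
proof -
  let ?\<gamma> = "\<lambda>q. christoffel g q v w" and ?T = "\<lambda>q. B q v w - L q v w *\<^sub>R n q"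
  note d = differentiable_patch[OF u]
  have dT: "?T differentiable at u"
    by (intro differentiable_diff differentiable_scaleR d)
  \<comment> \<open>The Christoffel field is a definite description at each point, so its
    differentiability is recovered from that of its image under \<open>D\<close>.\<close>
  have d\<gamma>: "?\<gamma> differentiable at u"
    by (rule differentiable_of_D_differentiable[OF u dT]) (rule D_christoffel)
  have "D u (cov_deriv g (\<lambda>q. q) ?\<gamma> u a)
     = D u (frechet_derivative ?\<gamma> (at u) a) + D u (christoffel g u a (?\<gamma> u))"
    unfolding cov_deriv_def by (simp add: D_simps[OF u] frechet_derivative_ident)
  also have "\<dots> = cov (\<lambda>q. D q (?\<gamma> q)) u a - L u a (?\<gamma> u) *\<^sub>R n u"
    unfolding cov_D_field(1)[OF u d\<gamma>] D_christoffel[OF u, of a] by simp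
  also have "cov (\<lambda>q. D q (?\<gamma> q)) u a = cov ?T u a"
    by (rule cov_cong[OF u]) (rule D_christoffel)
  also have "\<dots> = cov (\<lambda>q. B q v w) u a - L u v w *\<^sub>R cov n u a
      - frechet_derivative (\<lambda>q. L q v w) (at u) a *\<^sub>R n u"
    by (rule cov_diff_scaleR[OF d(4) d(2) d(5)])
  finally show ?thesis
    unfolding g_eq_D by (simp add: steady_metric_simps normal_n[OF u] weingarten[OF u])
qed

text \<open>The ambient curvature 1 contributes \<open>gram u\<close>, and the determinant of
  \<open>L\<close> enters with a minus sign because the normal is timelike. Both sides are
  multiplied by \<open>gram u\<close>, which keeps the equation free of denominators.\<close>

lemma gauss_equation:
  assumes u: "u \<in> V"
  shows "gauss_curvature g u * gram u = gram u -
    (L u (axis 1 1) (axis 1 1) * L u (axis 2 1) (axis 2 1) - (L u (axis 1 1) (axis 2 1))\<^sup>2)"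
proof -
  let ?a = "axis 1 1 :: real^2" and ?b = "axis 2 1 :: real^2"
  have const: "cov_deriv g (\<lambda>r. r) (\<lambda>_. w) q v = christoffel g q v w" for q v w
    by (simp add: cov_deriv_def frechet_derivative_ident)
  have "g u (riemann_curvature g u ?a ?b ?b) ?a
     = steady_metric (F u) (cov (\<lambda>q. B q ?b ?b) u ?a - cov (\<lambda>q. B q ?a ?b) u ?b) (D u ?a)
       - (L u ?b ?b * L u ?a ?a - L u ?a ?b * L u ?b ?a)"
    unfolding riemann_curvature_def const g_simps[OF u] tangential_second_derivative[OF u] steady_metric_simps
    by simp
  also have "cov (\<lambda>q. B q ?b ?b) u ?a - cov (\<lambda>q. B q ?a ?b) u ?b
     = g u ?b ?b *\<^sub>R D u ?a - g u ?b ?a *\<^sub>R D u ?b"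
    unfolding g_eq_D by (rule steady_curvature[OF open_V u smooth_F smooth_D])
  also have "steady_metric (F u) (g u ?b ?b *\<^sub>R D u ?a - g u ?b ?a *\<^sub>R D u ?b) (D u ?a) = gram u"
    using g_commute[of u ?a ?b] by (simp add: steady_metric_simps g_eq_D[symmetric] gram_def power2_eq_square)
  also have "L u ?b ?a = L u ?a ?b" using B_commute[OF u, of ?b ?a] by simp
  finally have R: "g u (riemann_curvature g u ?a ?b ?b) ?a
    = gram u - (L u ?a ?a * L u ?b ?b - (L u ?a ?b)\<^sup>2)" by (simp add: power2_eq_square)
  have "gauss_curvature g u = g u (riemann_curvature g u ?a ?b ?b) ?a / gram u"
    by (simp add: gauss_curvature_def Let_def gram_def)
  with R gram_pos[OF u] show ?thesis by simp
qed

text \<open>The field \<open>S\<close> is \<open>-A\<close>, so that slices have \<open>S = id\<close>.\<close>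

definition S :: "real^2 \<Rightarrow> real^2 \<Rightarrow> real^2" where
  "S u v = - shape_operator F n u v"

lemma D_S:
  assumes u: "u \<in> V" shows "D u (S u v) = cov n u v"
proof -
  obtain w where w: "D u w = - cov n u v"
    using tangent_ex[OF u, of "- cov n u v"] cov_n_tangent[OF u] by (auto simp: steady_metric_simps)
  have "shape_operator F n u v = w" unfolding shape_operator_def
    using w inj_D[OF u] by (intro the_equality) auto
  with w show ?thesis by (simp add: S_def D_simps[OF u])
qed

lemma g_S: "u \<in> V \<Longrightarrow> g u (S u v) w = L u v w"
  unfolding g_eq_D by (simp add: D_S weingarten)

lemma g_S_commute: "u \<in> V \<Longrightarrow> g u (S u v) w = g u v (S u w)"
  using B_commute[of u v w] by (simp add: g_S g_commute[of u v])

text \<open>Linearity is read off after applying the injective map \<open>D u\<close>, which turns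
  the definite description into the derivative of \<open>n\<close>.\<close>

lemma linear_S:
  assumes u: "u \<in> V" shows "linear (S u)"
proof (rule linearI)
  note ln = linear_frechet_derivative_smooth[OF smooth_n u]
  show "S u (v + w) = S u v + S u w" for v w
    by (rule inj_D[OF u]) (simp add: D_S[OF u] D_simps[OF u] cov_deriv_steady linear_add[OF ln] algebra_simps prod_eq_iff)
  show "S u (c *\<^sub>R v) = c *\<^sub>R S u v" for c v
    by (rule inj_D[OF u]) (simp add: D_S[OF u] D_simps[OF u] cov_deriv_steady linear_scale[OF ln] algebra_simps prod_eq_iff)
qed

text \<open>The coordinate basis need not be orthonormal: the determinant of \<open>L\<close> is
  that of the matrix of \<open>S\<close> times \<open>gram u\<close>, and the positive factor
  cancels from the Gauss equation.\<close>

lemma det_S_le_1: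
  assumes u: "u \<in> V" and K: "gauss_curvature g u \<ge> 0"
  shows "S u (axis 1 1) $ 1 * S u (axis 2 1) $ 2 - S u (axis 2 1) $ 1 * S u (axis 1 1) $ 2 \<le> 1"
    (is "?det \<le> 1")
proof -
  let ?a = "axis 1 1 :: real^2" and ?b = "axis 2 1 :: real^2"
  have coords: "S u v = S u v $ 1 *\<^sub>R ?a + S u v $ 2 *\<^sub>R ?b" for v
    by (simp add: vec_eq_iff forall_2 axis_def)
  have L: "L u v w = S u v $ 1 * g u ?a w + S u v $ 2 * g u ?b w" for v w
  proof -
    have "L u v w = g u (S u v) w" by (simp add: g_S[OF u])
    then show ?thesis by (subst (asm) coords) (simp add: g_simps[OF u])
  qed
  have "L u ?a ?b = L u ?b ?a" using B_commute[OF u, of ?b ?a] by simp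
  then have "L u ?a ?a * L u ?b ?b - (L u ?a ?b)\<^sup>2 = L u ?a ?a * L u ?b ?b - L u ?a ?b * L u ?b ?a"
    by (simp add: power2_eq_square)
  also have "\<dots> = ?det * gram u"
    unfolding L gram_def g_commute[of u ?b ?a] by (simp add: power2_eq_square algebra_simps)
  finally have "?det * gram u = gram u - gauss_curvature g u * gram u"
    using gauss_equation[OF u] by simp
  also have "\<dots> \<le> 1 * gram u" using K gram_pos[OF u] by simp
  finally show ?thesis using gram_pos[OF u] by simp
qed

lemma trace_S: "S u (axis 1 1) $ 1 + S u (axis 2 1) $ 2 = 2 * mean_curvature F n u"
  by (simp add: S_def mean_curvature_def trace_def matrix_def sum_2)

section \<open>The height function and the time component W of the normal\<close>

definition height_gradient :: "real^2 \<Rightarrow> real^2" where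
  "height_gradient u = gradient g (fst \<circ> F) u"

lemma height_gradient:
  assumes u: "u \<in> V"
  shows "g u (height_gradient u) v = fst (D u v)"
    and "g u (height_gradient u) (height_gradient u) = (fst (n u))\<^sup>2 - 1"
proof -
  \<comment> \<open>The ambient gradient of t is \<open>- del_t\<close>, and this vector is its
    tangential part, hence the image of grad h.\<close>
  have "steady_metric (F u) (n u) (fst (n u) *\<^sub>R n u - del_t) = 0"
    using unit_n[OF u] by (simp add: steady_metric_simps) (simp add: steady_metric_def del_t_def)
  then obtain z where z: "D u z = fst (n u) *\<^sub>R n u - del_t" using tangent_ex[OF u] by blast
  have gz: "g u z v = fst (D u v)" for v
    by (simp add: g_eq_D z steady_metric_simps normal_n[OF u]) (simp add: steady_metric_def del_t_def)
  have "((fst \<circ> F) has_derivative (\<lambda>v. fst (D u v))) (at u)"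
    unfolding o_def by (rule has_derivative_fst[OF smooth_on_has_derivative[OF smooth_F u]])
  from frechet_derivative_at[OF this, symmetric]
  have "gradient g (fst \<circ> F) u = z" unfolding gradient_def
    using gz g_nondegenerate[OF u] by (intro the_equality) auto
  then have *: "height_gradient u = z" by (simp add: height_gradient_def)
  show "g u (height_gradient u) v = fst (D u v)" using gz * by simp
  show "g u (height_gradient u) (height_gradient u) = (fst (n u))\<^sup>2 - 1"
    unfolding * gz z by (simp add: del_t_def power2_eq_square)
qed

lemma fst_n_ge_1: "u \<in> V \<Longrightarrow> fst (n u) \<ge> 1"
  using height_gradient(2)[of u] g_nonneg[of u "height_gradient u"] fst_n_pos[of u]
    power2_le_imp_le[of 1 "fst (n u)"] by simp

text \<open>This is grad W = (S - W) grad h, since \<open>S\<close> is symmetric. The Christoffel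
  part of the derivative of \<open>n\<close> has time component exp(2t) times the product of the
  horizontal parts of \<open>D u v\<close> and \<open>n u\<close>, which by normality equals
  \<open>fst (n u) * fst (D u v)\<close>.\<close>

lemma fst_n_derivative:
  assumes u: "u \<in> V"
  shows "((\<lambda>q. fst (n q)) has_derivative (\<lambda>v. fst (D u (S u v)) - fst (n u) * fst (D u v))) (at u)"
proof -
  have "fst (D u (S u v)) - fst (n u) * fst (D u v) = fst (frechet_derivative n (at u) v)" for v
    using normal_n[OF u, of v] unfolding D_S[OF u]
    by (simp add: cov_deriv_steady steady_metric_def inner_commute)
  then show ?thesis
    using has_derivative_fst[OF smooth_on_has_derivative[OF smooth_n u]] by simp
qed

text \<open>By the theorem of Cayley and Hamilton, \<open>T\<^sup>2 z - tr T * T z = - det T * z\<close> for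
  \<open>T = S - W\<close> and \<open>z = \<nabla>h\<close>; moreover \<open>\<nabla>W = T z\<close>.\<close>

lemma slope_fst_n:
  assumes u: "u \<in> V" and K: "gauss_curvature g u \<ge> 0" and H: "mean_curvature F n u = H"
    and bound: "fst (n u) \<le> H"
    and slope: "\<And>v. fst (D u (S u v)) - fst (n u) * fst (D u v) \<le> \<epsilon> * sqrt (g u v v)"
    and "\<epsilon> \<ge> 0"
  shows "2 * (H - 1) * ((fst (n u))\<^sup>2 - 1) \<le> \<epsilon>\<^sup>2 + 2 * (H - 1) * H * \<epsilon>"
proof -
  define W z where "W = fst (n u)" and "z = height_gradient u"
  define T where "T v = S u v - W *\<^sub>R v" for v
  have W: "1 \<le> W" "W \<le> H" using fst_n_ge_1[OF u] bound by (simp_all add: W_def)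
  have zz: "g u z z = W\<^sup>2 - 1" using height_gradient(2)[OF u] by (simp add: z_def W_def)
  have dW: "fst (D u (S u v)) - fst (n u) * fst (D u v) = g u z (T v)" for v
    using height_gradient(1)[OF u] by (simp add: T_def z_def g_simps[OF u] W_def)
  have T_sym: "g u (T v) w = g u v (T w)" for v w
    using g_S_commute[OF u] by (simp add: T_def g_simps[OF u])
  define s where "s i j = S u (axis j 1) $ i" for i j
  have S: "S u v $ i = s i 1 * v $ 1 + s i 2 * v $ 2" for v i
  proof -
    have "v = v $ 1 *\<^sub>R axis 1 1 + v $ 2 *\<^sub>R axis 2 1"
      by (simp add: vec_eq_iff forall_2 axis_def)
    then have "S u v = v $ 1 *\<^sub>R S u (axis 1 1) + v $ 2 *\<^sub>R S u (axis 2 1)"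
      by (metis linear_add[OF linear_S[OF u]] linear_scale[OF linear_S[OF u]])
    then show ?thesis by (simp add: s_def mult.commute)
  qed
  \<comment> \<open>Trace and negated determinant of \<open>T\<close>; the coordinate matrix may be
    used, as both are basis independent.\<close>
  define \<tau> \<kappa> where "\<tau> = 2 * (H - W)" and "\<kappa> = - ((s 1 1 - W) * (s 2 2 - W) - s 1 2 * s 2 1)"
  have tr: "s 1 1 + s 2 2 = 2 * H" using trace_S H by (simp add: s_def)
  have TT: "T (T v) = \<tau> *\<^sub>R T v + \<kappa> *\<^sub>R v" for v
  proof -
    have \<tau>: "\<tau> = s 1 1 + s 2 2 - 2 * W" using tr by (simp add: \<tau>_def)
    show ?thesis
      by (simp add: vec_eq_iff forall_2 T_def S \<tau> \<kappa>_def algebra_simps)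
  qed
  have "\<kappa> = (s 1 1 + s 2 2) * W - W\<^sup>2 - (s 1 1 * s 2 2 - s 1 2 * s 2 1)"
    by (simp add: \<kappa>_def power2_eq_square algebra_simps)
  then have "\<kappa> \<ge> 2 * H * W - W\<^sup>2 - 1" using det_S_le_1[OF u K] unfolding tr unfolding s_def by linarith
  \<comment> \<open>The excess of the lower bound for \<open>\<kappa>\<close> over
    \<open>2 * (H - 1)\<close>; both factors are nonnegative because 1 \<le> W \<le> H.\<close>
  moreover have "2 * H * W - W\<^sup>2 - 1 - 2 * (H - 1) = (W - 1) * (2 * H - 1 - W)"
    by (simp add: power2_eq_square algebra_simps)
  moreover have "(W - 1) * (2 * H - 1 - W) \<ge> 0" using W by simp
  ultimately have \<kappa>: "\<kappa> \<ge> 2 * (H - 1)" by linarith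
  \<comment> \<open>The slope bound tested in the direction of grad W itself, which is
    \<open>T z\<close>.\<close>
  have T1: "g u (T z) (T z) \<le> \<epsilon> * sqrt (g u (T z) (T z))"
    using slope[of "T z"] unfolding dW by (simp add: T_sym)
  have T2: "g u (T z) (T z) \<le> \<epsilon>\<^sup>2"
  proof (cases "g u (T z) (T z) = 0")
    case False
    then have pos: "sqrt (g u (T z) (T z)) > 0" using g_nonneg[OF u, of "T z"] by simp
    have "sqrt (g u (T z) (T z)) * sqrt (g u (T z) (T z)) \<le> \<epsilon> * sqrt (g u (T z) (T z))"
      using T1 g_nonneg[OF u, of "T z"] by simp
    then have "sqrt (g u (T z) (T z)) \<le> \<epsilon>" by (rule mult_right_le_imp_le[OF _ pos])
    then show ?thesis using g_nonneg[OF u, of "T z"] by (simp add: sqrt_le_D)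
  qed simp
  have "sqrt (W\<^sup>2 - 1) \<le> H" using W by (intro real_le_lsqrt) (auto intro: order_trans[OF _ power_mono[of W H 2]])
  then have "\<epsilon> * sqrt (g u z z) \<le> \<epsilon> * H" using \<open>\<epsilon> \<ge> 0\<close> by (simp add: zz mult_left_mono)
  \<comment> \<open>The slope bound tested against -grad h, with |grad h| at most \<open>H\<close>.
    This controls the trace term, whose sign is not known.\<close>
  then have "- g u (T z) z \<le> \<epsilon> * H"
    using slope[of "- z"] unfolding dW by (simp add: T_sym[symmetric] g_simps[OF u])
  moreover have "0 \<le> \<tau>" "\<tau> \<le> 2 * (H - 1)" using W by (simp_all add: \<tau>_def)
  ultimately have "\<tau> * (- g u (T z) z) \<le> 2 * (H - 1) * (\<epsilon> * H)"
    using W \<open>\<epsilon> \<ge> 0\<close> by (intro order_trans[OF mult_left_mono mult_right_mono]) auto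
  \<comment> \<open>Cayley-Hamilton paired with \<open>z\<close>: the determinant term is isolated
    and the other two terms are already small.\<close>
  moreover have "g u (T z) (T z) = \<tau> * g u (T z) z + \<kappa> * g u z z"
    using T_sym[of "T z" z] by (simp add: TT g_simps[OF u] g_commute)
  moreover have "2 * (H - 1) * g u z z \<le> \<kappa> * g u z z"
    using \<kappa> g_nonneg[OF u] by (simp add: mult_right_mono)
  ultimately show ?thesis using T2 unfolding zz W_def[symmetric] by (simp add: algebra_simps)
qed

end

section \<open>Rigidity: constancy of the height, then surjectivity onto the slice\<close>

theorem theorem4p5:
  fixes A :: "'s::{t2_space,second_countable_topology} atlas"
    and \<psi> N :: "'s \<Rightarrow> steady_state"
    and H :: real
  assumes surface: "smooth_atlas A" "connected (UNIV :: 's set)" "orientable_atlas A"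
    and immersion: "riemannian_immersion A \<psi>"
    and complete: "complete_immersion A \<psi>"
    and curvature: "\<And>V x u. (V, x) \<in> A \<Longrightarrow> u \<in> V \<Longrightarrow>
           gauss_curvature (induced_metric (\<psi> \<circ> x)) u \<ge> 0"
    and normal: "future_unit_normal A \<psi> N"
    and cmc: "\<And>V x u. (V, x) \<in> A \<Longrightarrow> u \<in> V \<Longrightarrow> mean_curvature (\<psi> \<circ> x) (N \<circ> x) u = H"
    and "H \<ge> 1"
    and gradient_bound: "\<And>V x u. (V, x) \<in> A \<Longrightarrow> u \<in> V \<Longrightarrow>
           norm_sq (induced_metric (\<psi> \<circ> x)) u
             (gradient (induced_metric (\<psi> \<circ> x)) (height \<psi> \<circ> x) u) \<le> H\<^sup>2 - 1"
  shows "\<exists>t0. range \<psi> = slice t0"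
proof -
  interpret connected_spacelike_surface A \<psi>
    by unfold_locales (use surface immersion in auto)
  have patch: "spacelike_patch V (\<psi> \<circ> x) (N \<circ> x)" if Vx: "(V, x) \<in> A" for V x
    using chart(1,6)[OF Vx] chart_g_pos[OF Vx] normal Vx
    by unfold_locales (auto simp: future_unit_normal_def)
  define W where "W p = fst (N p)" for p
  have W_bounds: "1 \<le> W p" "W p \<le> H" for p
  proof -
    obtain V x u where Vx: "(V, x) \<in> A" "u \<in> V" "x u = p" using chart_ex by blast
    interpret spacelike_patch V "\<psi> \<circ> x" "N \<circ> x" by (rule patch[OF Vx(1)])
    show W1: "1 \<le> W p" using fst_n_ge_1[OF Vx(2)] Vx(3) by (simp add: W_def)
    have "height \<psi> \<circ> x = fst \<circ> (\<psi> \<circ> x)" by (simp add: height_def o_assoc)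
    then have "(W p)\<^sup>2 - 1 \<le> H\<^sup>2 - 1"
      using gradient_bound[OF Vx(1,2)] height_gradient(2)[OF Vx(2)] Vx(3)
      by (simp add: norm_sq_def height_gradient_def W_def)
    then have "(W p)\<^sup>2 \<le> H\<^sup>2" by simp
    then show "W p \<le> H" by (rule power2_le_imp_le) (use \<open>H \<ge> 1\<close> in simp)
  qed
  \<comment> \<open>The differential found in \<open>fst_n_derivative\<close>, written without the
    patch locale because Ekeland's principle needs it for all charts at once.\<close>
  define dW where "dW V x u v = fst (frechet_derivative (\<psi> \<circ> x) (at u) (- shape_operator (\<psi> \<circ> x) (N \<circ> x) u v))
    - W (x u) * fst (frechet_derivative (\<psi> \<circ> x) (at u) v)" for V :: "(real^2) set" and x u v
  have W_deriv: "((\<lambda>w. W (x w)) has_derivative dW V x u) (at u)" if Vx: "(V, x) \<in> A" "u \<in> V" for V x u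
  proof -
    interpret spacelike_patch V "\<psi> \<circ> x" "N \<circ> x" by (rule patch[OF Vx(1)])
    show ?thesis using fst_n_derivative[OF Vx(2)] by (simp add: dW_def[abs_def] W_def S_def)
  qed
  have W1: "W p = 1" for p
  proof (rule ccontr)
    assume "W p \<noteq> 1"
    then have Wp: "1 < W p" using W_bounds(1)[of p] by simp
    then have H1: "H > 1" using W_bounds(2)[of p] by simp
    define \<delta> where "\<delta> = 2 * (H - 1) * ((W p)\<^sup>2 - 1)"
    \<comment> \<open>For \<epsilon> \<le> 1 the right-hand side of \<open>slope_fst_n\<close> is at
      most \<open>C * \<epsilon>\<close>; the choice of \<epsilon> below makes this at most
      \<open>\<delta> / 2\<close>, while the left-hand side is at least
      \<open>\<delta>\<close>.\<close>
    define C where "C = 1 + 2 * (H - 1) * H"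
    have \<delta>: "\<delta> > 0" using H1 Wp by (simp add: \<delta>_def)
    have C: "C > 0" using H1 by (simp add: C_def add_pos_nonneg)
    define \<epsilon> where "\<epsilon> = min 1 (\<delta> / (2 * C))"
    have \<epsilon>: "\<epsilon> > 0" "\<epsilon> \<le> 1" "\<epsilon> \<le> \<delta> / (2 * C)" using \<delta> C by (simp_all add: \<epsilon>_def)
    obtain V x u where Vx: "(V, x) \<in> A" "u \<in> V" "W p \<le> W (x u)"
      and slope: "\<And>v. dW V x u v \<le> \<epsilon> * sqrt (induced_metric (\<psi> \<circ> x) u v v)"
      using almost_maximum_small_slope[where f = W and f' = dW and b = p, OF complete W_bounds(2) W_deriv \<epsilon>(1)] by blast
    interpret spacelike_patch V "\<psi> \<circ> x" "N \<circ> x" by (rule patch[OF Vx(1)])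
    have "2 * (H - 1) * ((W (x u))\<^sup>2 - 1) \<le> \<epsilon>\<^sup>2 + 2 * (H - 1) * H * \<epsilon>"
      using slope_fst_n[OF Vx(2) curvature[OF Vx(1,2)] cmc[OF Vx(1,2)], of \<epsilon>] W_bounds(2)[of "x u"] slope \<epsilon>(1)
      by (simp add: W_def dW_def S_def)
    moreover have "\<delta> \<le> 2 * (H - 1) * ((W (x u))\<^sup>2 - 1)"
      unfolding \<delta>_def using H1 Vx(3) Wp by (intro mult_left_mono diff_right_mono power_mono) auto
    moreover have "\<epsilon>\<^sup>2 \<le> 1 * \<epsilon>" unfolding power2_eq_square using \<epsilon> by (intro mult_right_mono) auto
    moreover have "\<epsilon> + 2 * (H - 1) * H * \<epsilon> = C * \<epsilon>" by (simp add: C_def algebra_simps)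
    moreover have "C * \<epsilon> \<le> \<delta> / 2" using \<epsilon>(3) C by (simp add: field_simps)
    ultimately show False using \<delta> by linarith
  qed
  have dh: "fst (frechet_derivative (\<psi> \<circ> x) (at u) v) = 0" if Vx: "(V, x) \<in> A" "u \<in> V" for V x u v
  proof -
    interpret spacelike_patch V "\<psi> \<circ> x" "N \<circ> x" by (rule patch[OF Vx(1)])
    have "g u (height_gradient u) (height_gradient u) = 0"
      using height_gradient(2)[OF Vx(2)] W1[of "x u"] by (simp add: W_def)
    then have "height_gradient u = 0" using spacelike[OF Vx(2), of "height_gradient u"] by auto
    then show ?thesis using height_gradient(1)[OF Vx(2), of v] by (simp add: g_simps[OF Vx(2)])
  qed
  have h_const: "fst (\<psi> p) = fst (\<psi> q)" for p q
  \<comment> \<open>In a chart ball, which is convex, a vanishing differential gives constancy;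
    connectedness of the surface does the rest.\<close>
  proof (rule connected_local_const[OF surface(2), of p q "\<lambda>p. fst (\<psi> p)"])
    show "\<forall>p\<in>UNIV. \<forall>\<^sub>F q in at p. fst (\<psi> p) = fst (\<psi> q)"
    proof
      fix p
      obtain V x u where Vx: "(V, x) \<in> A" "u \<in> V" "x u = p" using chart_ex by blast
      obtain r where r: "r > 0" "ball u r \<subseteq> V" using chart(1)[OF Vx(1)] Vx(2) open_contains_ball by blast
      have D: "((\<lambda>w. fst (\<psi> (x w))) has_derivative (\<lambda>h. 0)) (at w within ball u r)" if "w \<in> ball u r" for w
      proof -
        have w: "w \<in> V" using that r by auto
        have "((\<lambda>w. fst ((\<psi> \<circ> x) w)) has_derivative (\<lambda>v. fst (frechet_derivative (\<psi> \<circ> x) (at w) v))) (at w)"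
          by (rule has_derivative_fst[OF smooth_on_has_derivative[OF chart(6)[OF Vx(1)] w]])
        then show ?thesis using dh[OF Vx(1) w] by (auto intro: has_derivative_at_withinI)
      qed
      have "fst (\<psi> p) = fst (\<psi> q)" if q: "q \<in> x ` ball u r" for q
      proof -
        obtain w where w: "w \<in> ball u r" "q = x w" using q by blast
        have "fst (\<psi> (x w)) = fst (\<psi> (x u))"
          by (rule has_derivative_zero_unique[OF convex_ball D w(1)]) (use r in auto)
        then show ?thesis using w(2) Vx(3) by simp
      qed
      moreover have "open (x ` ball u r)" using chart_open_image[OF Vx(1) _ r(2)] by simp
      moreover have "p \<in> x ` ball u r" using imageI[of u "ball u r" x] Vx(3) r(1) by simp
      ultimately show "\<forall>\<^sub>F q in at p. fst (\<psi> p) = fst (\<psi> q)"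
        unfolding eventually_at_topological by blast
    qed
  qed auto
  \<comment> \<open>Any point will do; \<open>undefined\<close> merely names one.\<close>
  define t0 where "t0 = fst (\<psi> undefined)"
  have t0: "fst (\<psi> p) = t0" for p unfolding t0_def by (rule h_const)
  have onto: "\<exists>p. snd (\<psi> p) = y" for y
  proof (rule ccontr)
    assume none: "\<nexists>p. snd (\<psi> p) = y"
    define f where "f p = - norm (y - snd (\<psi> p))" for p
    define df where "df V x u v = sgn (y - snd (\<psi> (x u))) \<bullet> snd (frechet_derivative (\<psi> \<circ> x) (at u) v)"
      for V :: "(real^2) set" and x and u v :: "real^2"
    have f_deriv: "((\<lambda>w. f (x w)) has_derivative df V x u) (at u)" if Vx: "(V, x) \<in> A" "u \<in> V" for V x u
    proof -
      have 1: "((\<lambda>w. y - snd ((\<psi> \<circ> x) w)) has_derivative (\<lambda>v. 0 - snd (frechet_derivative (\<psi> \<circ> x) (at u) v))) (at u)"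
        by (intro has_derivative_diff has_derivative_const has_derivative_snd
            smooth_on_has_derivative[OF chart(6)[OF Vx(1)] Vx(2)])
      \<comment> \<open>As \<open>y\<close> is missed, the norm is differentiated away from its only
        singular point.\<close>
      have "y - snd ((\<psi> \<circ> x) u) \<noteq> 0" using none by (metis comp_apply right_minus_eq)
      note 2 = has_derivative_compose[OF 1 has_derivative_norm[OF this]]
      show ?thesis using has_derivative_minus[OF 2]
        by (simp add: f_def df_def[abs_def] inner_commute)
    qed
    have "f p \<le> 0" for p by (simp add: f_def)
    \<comment> \<open>Half of the slope that \<open>f\<close> has at every point of a surface of
      height \<open>t0\<close>.\<close>
    moreover have "exp (- t0) / 2 > 0" by simp
    ultimately obtain V x u where Vx: "(V, x) \<in> A" "u \<in> V"
      and slope: "\<And>v. df V x u v \<le> exp (- t0) / 2 * sqrt (induced_metric (\<psi> \<circ> x) u v v)"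
      using almost_maximum_small_slope[where f = f and f' = df, OF complete _ f_deriv] by blast
    interpret spacelike_patch V "\<psi> \<circ> x" "N \<circ> x" by (rule patch[OF Vx(1)])
    let ?e = "sgn (y - snd (\<psi> (x u)))"
    have "y - snd (\<psi> (x u)) \<noteq> 0" using none by (metis right_minus_eq)
    then have e: "?e \<bullet> ?e = 1" by (simp add: norm_sgn flip: power2_norm_eq_inner)
    \<comment> \<open>The tangent vector whose horizontal part is the unit vector towards
      \<open>y\<close>: along it \<open>f\<close> grows at rate 1, while its induced length is
      \<open>exp t0\<close>, so the slope bound would give 1 \<le> 1/2.\<close>
    obtain v where v: "snd (D u v) = ?e" using ex_snd_D[OF Vx(2)] by blast
    have "g u v v = exp (2 * t0)"
      using dh[OF Vx, of v] t0 v e by (simp add: g_eq_D steady_metric_def)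
    also have "\<dots> = (exp t0)\<^sup>2" by (simp add: exp_double)
    finally have "sqrt (g u v v) = exp t0" by simp
    then have "df V x u v \<le> 1 / 2" using slope[of v] by (simp add: exp_minus)
    moreover have "df V x u v = 1" using v e by (simp add: df_def)
    ultimately show False by simp
  qed
  have "range \<psi> = slice t0"
  proof
    have "\<psi> p \<in> slice t0" for p using t0[of p] by (simp add: slice_def mem_Times_iff)
    then show "range \<psi> \<subseteq> slice t0" by blast
    show "slice t0 \<subseteq> range \<psi>"
    proof
      fix q assume q: "q \<in> slice t0"
      obtain p where "snd (\<psi> p) = snd q" using onto by blast
      then have "q = \<psi> p" using q t0[of p] by (simp add: slice_def mem_Times_iff prod_eq_iff)
      then show "q \<in> range \<psi>" by blast
    qed
  qed
  then show ?thesis by blast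
qed

end
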